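(* Let $n$ and $k$ be integers with $n\geqslant 2$ and $0\leqslant k\leqslant n-2$, and let $S_n$ be the $n$-dimensional star graph. Then the $k$-super connectivity and the $k$-super edge-connectivity of $S_n$ satisfy $$\kappa_s^{(k)}(S_n)=\lambda_s^{(k)}(S_n)=(k+1)!\,(n-k-1).$$
   Context: Star graph: for an integer $n\geqslant 2$, let $I_n=\{1,2,\ldots,n\}$ and $I'_n=\{2,\ldots,n\}$. The $n$-dimensional star graph $S_n$ is the undirected graph whose vertices are all permutations $p_1p_2\ldots p_n$ of $I_n$ (so $n!$ vertices), where the vertex $p_1p_2\ldots p_n$ is adjacent to exactly the vertices $p_ip_2\ldots p_{i-1}p_1p_{i+1}\ldots p_n$ for $i\in I'_n$, i.e. those obtained by exchanging the symbol in the first position with the symbol in position $i$. It is $(n-1)$-regular. $k$-super connectivity: let $G$ be a connected graph and $k\geqslant 0$ an integer. A subset $S\subset V(G)$ is a $k$-vertex-cut if $G-S$ is disconnected and every vertex of $G-S$ has degree at least $k$ in $G-S$. A subset $F\subset E(G)$ is a $k$-edge-cut if $G-F$ is disconnected and every vertex has degree at least $k$ in $G-F$. The $k$-super connectivity $\kappa_s^{(k)}(G)$ (resp. $k$-super edge-connectivity $\lambda_s^{(k)}(G)$) is the minimum cardinality of a $k$-vertex-cut (resp. $k$-edge-cut) of $G$; a statement about its value includes the assertion that such a cut exists. For $k=0$ these are the usual connectivity $\kappa(G)$ and edge-connectivity $\lambda(G)$, with the usual convention that the connectivity of the complete graph $K_m$ is $m-1$; this convention matters only for $S_2=K_2$,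 for which $\kappa_s^{(0)}(S_2)=\kappa(K_2)=1$ (as $K_2$ has no vertex-cut). *)

theory Defs
  imports
    Graph_Theory.Graph_Theory
    "HOL-Library.Extended_Nat"
    "HOL-Combinatorics.Permutations"
begin

text \<open>
  A finite simple undirected graph is a symmetric digraph, as in the locale \<^locale>\<open>graph\<close>:
  an undirected edge is the two-element set of the ends of a pair of opposite arcs.
  In particular the degree of a vertex is its out-degree.
\<close>

definition edges :: "('a, 'b) pre_digraph \<Rightarrow> 'a set set" where
  "edges G = {{u, v} | u v. u \<rightarrow>\<^bsub>G\<^esub> v}"

definition delete_verts :: "('a, 'b) pre_digraph \<Rightarrow> 'a set \<Rightarrow> ('a, 'b) pre_digraph" where
  "delete_verts G S = G \<restriction> (verts G - S)"

definition delete_edges :: "('a, 'b) pre_digraph \<Rightarrow> 'a set set \<Rightarrow> ('a, 'b) pre_digraph" where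
  "delete_edges G F = G\<lparr>arcs := {e \<in> arcs G. {tail G e, head G e} \<notin> F}\<rparr>"

text \<open>
  \<^const>\<open>connected\<close> is false for the graph without vertices, which is not a
  disconnected graph either: deleting all vertices does not give a vertex cut.
\<close>

definition disconnected :: "('a, 'b) pre_digraph \<Rightarrow> bool" where
  "disconnected G \<longleftrightarrow> verts G \<noteq> {} \<and> \<not> connected G"

definition vertex_cut :: "nat \<Rightarrow> ('a, 'b) pre_digraph \<Rightarrow> 'a set \<Rightarrow> bool" where
  "vertex_cut k G S \<longleftrightarrow> S \<subseteq> verts G \<and> disconnected (delete_verts G S) \<and>
     (\<forall>v \<in> verts (delete_verts G S). k \<le> out_degree (delete_verts G S) v)"

definition edge_cut :: "nat \<Rightarrow> ('a, 'b) pre_digraph \<Rightarrow> 'a set set \<Rightarrow> bool" where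
  "edge_cut k G F \<longleftrightarrow> F \<subseteq> edges G \<and> disconnected (delete_edges G F) \<and>
     (\<forall>v \<in> verts (delete_edges G F). k \<le> out_degree (delete_edges G F) v)"

text \<open>
  The infimum of the empty set is \<^term>\<open>\<infinity> :: enat\<close>, so a finite value is attained by a cut.
  A complete graph has no vertex cut; its connectivity (the case \<^prop>\<open>k = 0\<close>) is by
  convention the number of its vertices minus one.
\<close>

definition super_connectivity :: "nat \<Rightarrow> ('a, 'b) pre_digraph \<Rightarrow> enat" where
  "super_connectivity k G =
     (if k = 0 \<and> complete_digraph (card (verts G)) G then enat (card (verts G) - 1)
      else INF S \<in> {S. vertex_cut k G S}. enat (card S))"

definition super_edge_connectivity :: "nat \<Rightarrow> ('a, 'b) pre_digraph \<Rightarrow> enat" where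
  "super_edge_connectivity k G = (INF F \<in> {F. edge_cut k G F}. enat (card F))"

text \<open>
  The permutation \<open>p\<^sub>1 \<dots> p\<^sub>n\<close> is the function \<open>i \<mapsto> p\<^sub>i\<close>, which is the identity outside
  \<open>{1..n}\<close>. Composing it on the right with \<^term>\<open>transpose 1 i\<close> exchanges the symbols in the
  positions \<open>1\<close> and \<open>i\<close>.
\<close>

definition star_graph :: "nat \<Rightarrow> (nat \<Rightarrow> nat) pair_pre_digraph" where
  "star_graph n =
     \<lparr>pverts = {p. p permutes {1..n}},
      parcs = {(p, p \<circ> transpose 1 i) | p i. p permutes {1..n} \<and> i \<in> {2..n}}\<rparr>"

lemma pair_graph_star_graph: "pair_graph (star_graph n)"
proof
  let ?A = "{p. p permutes {1..n}}"
  have closed: "p \<circ> transpose 1 i permutes {1..n}" if "p permutes {1..n}" "i \<in> {2..n}" for p i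
  proof (rule permutes_compose)
    show "transpose 1 i permutes {1..n}"
      using that(2) by (intro permutes_swap_id) auto
  qed (rule that(1))
  have arcs: "parcs (star_graph n) = {(p, p \<circ> transpose 1 i) | p i. p \<in> ?A \<and> i \<in> {2..n}}"
    and verts: "pverts (star_graph n) = ?A"
    by (simp_all add: star_graph_def)
  have fin: "finite ?A"
    by (rule finite_permutations) simp
  have sub: "parcs (star_graph n) \<subseteq> ?A \<times> ?A"
    unfolding arcs using closed by blast
  show "finite (pverts (star_graph n))"
    unfolding verts by (rule fin)
  show "finite (parcs (star_graph n))"
    using fin sub by (meson finite_SigmaI finite_subset)
  show "fst e \<in> pverts (star_graph n)" "snd e \<in> pverts (star_graph n)"
    if "e \<in> parcs (star_graph n)" for e
    using subsetD[OF sub that] unfolding verts by (simp_all add: mem_Times_iff)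
  show "fst e \<noteq> snd e" if "e \<in> parcs (star_graph n)" for e
  proof -
    from that obtain p i where e: "e = (p, p \<circ> transpose 1 i)" "p permutes {1..n}" "i \<in> {2..n}"
      unfolding arcs by blast
    have "i \<noteq> 1"
      using e(3) by simp
    then have "p i \<noteq> p 1"
      by (simp add: inj_eq[OF permutes_inj[OF e(2)]])
    then have "(p \<circ> transpose 1 i) 1 \<noteq> p 1"
      by simp
    then show ?thesis
      unfolding e(1) fst_conv snd_conv by metis
  qed
  show "symmetric (star_graph n)"
    unfolding symmetric_def with_proj_simps
  proof (rule symI)
    fix p q
    assume "(p, q) \<in> parcs (star_graph n)"
    then obtain i where i: "p \<in> ?A" "i \<in> {2..n}" "q = p \<circ> transpose 1 i"
      unfolding arcs by blast
    have "q \<circ> transpose 1 i = p"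
      unfolding i(3) comp_assoc transpose_comp_involutory by (rule comp_id)
    then have "p = q \<circ> transpose 1 i"
      by (rule sym)
    moreover have "q \<in> ?A"
      using i closed by simp
    ultimately show "(q, p) \<in> parcs (star_graph n)"
      unfolding arcs using i(2) by blast
  qed
qed

end

theory Submission
  imports Defs
begin

text \<open>
  Fix a position \<open>i\<close> other than \<open>1\<close>. Its symbol is changed only by the exchange along \<open>i\<close>, so the
  \<open>n\<close> values of that symbol cut the \<open>n\<close>-dimensional star graph into \<open>n\<close> fibres, each an
  \<open>(n - 1)\<close>-dimensional star graph, and each vertex has exactly one neighbour outside its fibre.
  The lower bound is an induction along such splittings.
  
  Vertex cuts and edge cuts are treated at once. Both give disjoint nonempty vertex sets
  \<open>X\<close> and \<open>Y\<close> of minimum degree at least \<open>k\<close> in their induced subgraphs: a vertex cut consists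
  of the vertices outside \<open>X \<union> Y\<close>, with no edge between \<open>X\<close> and \<open>Y\<close>, and an edge cut contains all
  edges between \<open>X\<close> and \<open>Y = V - X\<close>. What is bounded from below is the number of vertices
  outside \<open>X \<union> Y\<close> plus the number of edges between \<open>X\<close> and \<open>Y\<close> (lemma \<open>cost_ge_fact\<close>).
  This sum is at least the sum of its values in the fibres. In a fibre met by both sets the
  minimum degrees drop by at most one, so for \<open>k > 0\<close> such a mixed fibre contributes
  \<open>k! (n - k - 1)\<close> by induction; for \<open>k = 0\<close> there is a separate induction on \<open>n\<close>.
  
  If some splitting has \<open>k + 1\<close> mixed fibres, the bound follows. Otherwise, suppose that it has
  fibres that miss \<open>Y\<close> and others that miss \<open>X\<close>. The \<open>(n - 2)!\<close> edges between a fibre of the first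
  kind and one of the second form a matching, and each of them has an end outside \<open>X \<union> Y\<close> or
  joins \<open>X\<close> to \<open>Y\<close>. Taken over all such pairs, and together with the mixed fibres, this is again
  enough. What remains is that for each \<open>i\<close> one of the two sets is confined to at most \<open>k\<close> fibres,
  all of them mixed. Here the decisive fact is \<open>exists_spread_position\<close>: a nonempty set
  of minimum degree at least \<open>k\<close> shows at least \<open>k + 1\<close> different symbols in some position.
  Applied to \<open>Y\<close> it gives a position where \<open>X\<close> is the confined set, and applied to \<open>X\<close> another
  one where \<open>Y\<close> is. A vertex that avoids the mixed fibres of both positions lies neither in \<open>X\<close>
  nor in \<open>Y\<close>, and there are enough such vertices.
  
  For the upper bound take the permutations of \<open>{1..k+1}\<close>, a substar of degree \<open>k\<close> with
  \<open>(k + 1)!\<close> vertices, and delete its neighbours, or the edges that leave it. Every remaining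
  vertex outside has lost at most one neighbour, so its degree is at least \<open>n - 2 \<ge> k\<close>.
  For \<open>n = 2\<close> the graph is complete and its connectivity is a convention.
\<close>

section \<open>Star graphs on arbitrary positions and symbols\<close>

text \<open>
  The vertices of a star graph whose positions and symbols form arbitrary finite sets of equal
  size. The values outside \<open>S\<close> are prescribed by \<open>f\<close>: then fixing the symbol of one
  position gives a set of the same form, inside the same function type.
\<close>

definition arrangements :: "'a set \<Rightarrow> 'b set \<Rightarrow> ('a \<Rightarrow> 'b) \<Rightarrow> ('a \<Rightarrow> 'b) set" where
  "arrangements S A f = {p. bij_betw p S A \<and> (\<forall>x. x \<notin> S \<longrightarrow> p x = f x)}"

definition fibre :: "('a \<Rightarrow> 'b) set \<Rightarrow> 'a \<Rightarrow> 'b \<Rightarrow> ('a \<Rightarrow> 'b) set" where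
  "fibre X i j = {p \<in> X. p i = j}"

text \<open>
  The centre \<open>r\<close> plays the role of position \<open>1\<close>. Different moves of an arrangement lead to different
  neighbours, so the number of moves into \<open>X\<close> is its degree into \<open>X\<close>.
\<close>

definition moves :: "'a set \<Rightarrow> 'a \<Rightarrow> ('a \<Rightarrow> 'b) set \<Rightarrow> ('a \<Rightarrow> 'b) \<Rightarrow> 'a set" where
  "moves S r X p = {i \<in> S - {r}. p \<circ> transpose r i \<in> X}"

text \<open>
  The quantity that measures vertex cuts and edge cuts at once: vertices outside \<open>X \<union> Y\<close> plus edges
  between \<open>X\<close> and \<open>Y\<close>, an edge being listed as a vertex of \<open>X\<close> with a move into \<open>Y\<close>.
\<close>

definition cost ::
  "'a set \<Rightarrow> 'a \<Rightarrow> 'b set \<Rightarrow> ('a \<Rightarrow> 'b) \<Rightarrow> ('a \<Rightarrow> 'b) set \<Rightarrow> ('a \<Rightarrow> 'b) set \<Rightarrow> nat" where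
  "cost S r A f X Y =
     card (arrangements S A f - (X \<union> Y)) + card (SIGMA p:X. moves S r Y p)"

lemma comp_transpose_twice [simp]: "p \<circ> transpose a b \<circ> transpose a b = p"
  by (simp add: comp_assoc)

lemma fibre_arrangements:
  assumes "i \<in> S" and "j \<in> A"
  shows "fibre (arrangements S A f) i j = arrangements (S - {i}) (A - {j}) (f(i := j))"
proof (intro equalityI subsetI)
  fix p
  assume "p \<in> fibre (arrangements S A f) i j"
  then have p: "bij_betw p S A" "\<And>x. x \<notin> S \<Longrightarrow> p x = f x" "p i = j"
    by (auto simp: fibre_def arrangements_def)
  have "bij_betw p (S - {i}) (A - {j})"
    using bij_betw_DiffI[OF p(1), of "{i}" "{j}"] assms p(3) by (auto simp: bij_betw_def)
  then show "p \<in> arrangements (S - {i}) (A - {j}) (f(i := j))"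
    using p by (auto simp: arrangements_def)
next
  fix p
  assume p: "p \<in> arrangements (S - {i}) (A - {j}) (f(i := j))"
  then have "p i = j"
    by (simp add: arrangements_def)
  moreover have "bij_betw p (insert i (S - {i})) (insert j (A - {j}))"
    using p \<open>p i = j\<close>
    by (metis (lifting) Diff_iff arrangements_def mem_Collect_eq notIn_Un_bij_betw insert_is_Un
        Un_commute singletonI)
  ultimately show "p \<in> fibre (arrangements S A f) i j"
    using p assms by (auto simp: fibre_def arrangements_def insert_absorb)
qed

lemma arrangements_apply: "p \<in> arrangements S A f \<Longrightarrow> i \<in> S \<Longrightarrow> p i \<in> A"
  by (auto simp: arrangements_def dest: bij_betwE)

lemma card_eq_sum_fibres:
  assumes "finite X" and "finite A" and "\<And>p. p \<in> X \<Longrightarrow> p i \<in> A"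
  shows "card X = (\<Sum>j\<in>A. card (fibre X i j))"
proof -
  have "card (\<Union>j\<in>A. fibre X i j) = (\<Sum>j\<in>A. card (fibre X i j))"
    using assms by (intro card_UN_disjoint) (auto simp: fibre_def)
  moreover have "(\<Union>j\<in>A. fibre X i j) = X"
    using assms(3) by (auto simp: fibre_def)
  ultimately show ?thesis by simp
qed

lemma card_arrangements:
  assumes "finite S" and "finite A" and "card A = card S"
  shows "finite (arrangements S A f) \<and> card (arrangements S A f) = fact (card S)"
  using assms
proof (induction "card S" arbitrary: S A f)
  case 0
  then have "arrangements S A f = {f}"
    by (auto simp: arrangements_def bij_betw_def)
  then show ?case using 0 by simp
next
  case (Suc n)
  then obtain i where i: "i \<in> S" by fastforce
  have A: "p i \<in> A" if "p \<in> arrangements S A f" for p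
    using that i by (rule arrangements_apply)
  have fib: "finite (fibre (arrangements S A f) i j) \<and> card (fibre (arrangements S A f) i j) = fact n"
    if "j \<in> A" for j
  proof -
    have "card (S - {i}) = n" "card (A - {j}) = n"
      using that Suc.hyps(2) Suc.prems i by (simp_all add: card_Diff_singleton)
    then show ?thesis
      using that i Suc.prems Suc.hyps(1)[of "S - {i}" "A - {j}" "f(i := j)"]
      by (simp add: fibre_arrangements)
  qed
  have "arrangements S A f = (\<Union>j\<in>A. fibre (arrangements S A f) i j)"
    using A by (auto simp: fibre_def)
  then have fin: "finite (arrangements S A f)"
    using fib \<open>finite A\<close> by (metis (no_types, lifting) finite_UN_I)
  have "card (arrangements S A f) = (\<Sum>j\<in>A. fact n)"
    using card_eq_sum_fibres[OF fin \<open>finite A\<close> A] fib by simp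
  with fin show ?case
    using Suc.prems(3) by (simp flip: Suc.hyps(2))
qed

lemma card_two_values:
  assumes "finite S" "finite A" "card A = card S" "i \<in> S" "l \<in> S" "i \<noteq> l"
    and Q: "Q \<subseteq> A \<times> A" "\<And>a. (a, a) \<notin> Q"
  shows "card {p \<in> arrangements S A f. (p i, p l) \<in> Q} = card Q * fact (card S - 2)"
proof -
  let ?V = "arrangements S A f"
  have finV: "finite ?V" using card_arrangements[OF assms(1-3)] by simp
  have finQ: "finite Q" using Q assms by (meson finite_SigmaI finite_subset)
  have one: "card (fibre (fibre ?V i a) l b) = fact (card S - 2)" if "(a, b) \<in> Q" for a b
  proof -
    have ab: "a \<in> A" "b \<in> A" "a \<noteq> b" using that Q by auto
    have "fibre (fibre ?V i a) l b
        = arrangements (S - {i} - {l}) (A - {a} - {b}) (f(i := a, l := b))"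
      using ab assms by (subst fibre_arrangements, simp, simp)+ simp
    moreover have "card (S - {i} - {l}) = card S - 2" "card (A - {a} - {b}) = card S - 2"
      using ab assms by (simp_all add: card_Diff_singleton)
    ultimately show ?thesis
      using card_arrangements[of "S - {i} - {l}" "A - {a} - {b}"] assms by simp
  qed
  have "{p \<in> ?V. (p i, p l) \<in> Q} = (\<Union>(a, b)\<in>Q. fibre (fibre ?V i a) l b)"
    by (auto simp: fibre_def)
  also have "card \<dots> = (\<Sum>(a, b)\<in>Q. card (fibre (fibre ?V i a) l b))"
    using finV finQ by (subst card_UN_disjoint) (auto simp: fibre_def case_prod_unfold)
  also have "\<dots> = (\<Sum>(a, b)\<in>Q. fact (card S - 2))"
    using one by (intro sum.cong) auto
  finally show ?thesis by (simp add: case_prod_unfold)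
qed

section \<open>Splitting a pair of vertex sets along a position\<close>

locale disjoint_pair =
  fixes S :: "'a set" and r :: 'a and A :: "'b set" and f :: "'a \<Rightarrow> 'b"
    and X Y :: "('a \<Rightarrow> 'b) set"
  assumes fin: "finite S" "finite A" and card_eq: "card A = card S" and root: "r \<in> S"
    and sub: "X \<subseteq> arrangements S A f" "Y \<subseteq> arrangements S A f"
    and disj: "X \<inter> Y = {}"
begin

abbreviation "V \<equiv> arrangements S A f"
abbreviation "Z \<equiv> V - (X \<union> Y)"

lemma finite_V: "finite V" and card_V: "card V = fact (card S)"
  using card_arrangements[OF fin card_eq] by simp_all

lemma finite_XY: "finite X" "finite Y"
  using finite_V sub by (auto dest: finite_subset)

lemma symbol_in: "p \<in> V \<Longrightarrow> i \<in> S \<Longrightarrow> p i \<in> A"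
  by (rule arrangements_apply)

lemma symbol_inj: "p \<in> V \<Longrightarrow> i \<in> S \<Longrightarrow> l \<in> S \<Longrightarrow> p i = p l \<Longrightarrow> i = l"
  by (auto simp: arrangements_def bij_betw_def inj_on_def)

lemma move_closed:
  assumes "p \<in> V" and "i \<in> S"
  shows "p \<circ> transpose r i \<in> V"
proof -
  have t: "transpose r i permutes S"
    using root assms by (intro permutes_swap_id)
  have "bij_betw (p \<circ> transpose r i) S A"
    using assms by (intro bij_betw_trans[OF permutes_imp_bij[OF t]]) (simp add: arrangements_def)
  moreover have "(p \<circ> transpose r i) x = f x" if "x \<notin> S" for x
    using assms permutes_not_in[OF t that] that by (simp add: arrangements_def)
  ultimately show ?thesis by (simp add: arrangements_def)
qed

lemma fibre_pair:
  assumes "i \<in> S - {r}" and "j \<in> A"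
  shows "disjoint_pair (S - {i}) r (A - {j}) (f(i := j)) (fibre X i j) (fibre Y i j)"
proof
  have "fibre V i j = arrangements (S - {i}) (A - {j}) (f(i := j))"
    using assms by (intro fibre_arrangements) auto
  then show "fibre X i j \<subseteq> arrangements (S - {i}) (A - {j}) (f(i := j))"
    and "fibre Y i j \<subseteq> arrangements (S - {i}) (A - {j}) (f(i := j))"
    using sub by (auto simp: fibre_def)
  show "card (A - {j}) = card (S - {i})"
    using fin card_eq assms by (simp add: card_Diff_singleton)
qed (use fin root disj assms in \<open>auto simp: fibre_def\<close>)

abbreviation "fibre_cost i j \<equiv>
  cost (S - {i}) r (A - {j}) (f(i := j)) (fibre X i j) (fibre Y i j)"

text \<open>
  An exchange along another position stays in its fibre and is counted there. What no
  fibre counts are the exchanges along \<open>i\<close> itself.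
\<close>

lemma cost_split:
  assumes i: "i \<in> S - {r}"
  shows "cost S r A f X Y = (\<Sum>j\<in>A. fibre_cost i j) + card {p \<in> X. p \<circ> transpose r i \<in> Y}"
proof -
  let ?E = "SIGMA p:X. moves S r Y p"
  let ?F = "\<lambda>j. SIGMA p:fibre X i j. moves (S - {i}) r (fibre Y i j) p"
  let ?C = "(\<lambda>p. (p, i)) ` {p \<in> X. p \<circ> transpose r i \<in> Y}"
  have val: "p \<in> X \<Longrightarrow> p i \<in> A" for p using symbol_in sub i by auto
  have "?E = (\<Union>j\<in>A. ?F j) \<union> ?C"
  proof (intro equalityI subsetI)
    fix e assume "e \<in> ?E"
    then obtain p l where e: "e = (p, l)" "p \<in> X" "l \<in> S" "l \<noteq> r" "p \<circ> transpose r l \<in> Y"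
      by (auto simp: moves_def)
    show "e \<in> (\<Union>j\<in>A. ?F j) \<union> ?C"
    proof (cases "l = i")
      case False
      then have "(p \<circ> transpose r l) i = p i" using i by simp
      then show ?thesis using e False val[OF e(2)] by (auto simp: fibre_def moves_def)
    qed (use e in auto)
  next
    fix e assume "e \<in> (\<Union>j\<in>A. ?F j) \<union> ?C"
    then show "e \<in> ?E" using i by (auto simp: fibre_def moves_def)
  qed
  moreover have "(\<Union>j\<in>A. ?F j) \<inter> ?C = {}" by (auto simp: moves_def)
  moreover have finF: "finite (?F j)" for j
    using finite_XY fin by (intro finite_SigmaI) (auto simp: fibre_def moves_def)
  ultimately have "card ?E = card (\<Union>j\<in>A. ?F j) + card ?C"
    using finite_XY fin by (simp add: card_Un_disjoint)
  also have "card (\<Union>j\<in>A. ?F j) = (\<Sum>j\<in>A. card (?F j))"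
    using finF fin by (intro card_UN_disjoint) (auto simp: fibre_def)
  also have "card ?C = card {p \<in> X. p \<circ> transpose r i \<in> Y}"
    by (intro card_image) (auto simp: inj_on_def)
  finally have E: "card ?E = (\<Sum>j\<in>A. card (?F j)) + card {p \<in> X. p \<circ> transpose r i \<in> Y}" .
  have "card Z = (\<Sum>j\<in>A. card (fibre Z i j))"
    using finite_V fin i symbol_in by (intro card_eq_sum_fibres) auto
  also have "\<dots> = (\<Sum>j\<in>A. card (arrangements (S - {i}) (A - {j}) (f(i := j)) - (fibre X i j \<union> fibre Y i j)))"
  proof (intro sum.cong refl arg_cong[where f = card])
    fix j assume "j \<in> A"
    then have "fibre V i j = arrangements (S - {i}) (A - {j}) (f(i := j))"
      using i by (intro fibre_arrangements) auto
    then show "fibre Z i j = arrangements (S - {i}) (A - {j}) (f(i := j)) - (fibre X i j \<union> fibre Y i j)"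
      by (auto simp: fibre_def)
  qed
  finally show ?thesis
    using E by (simp add: cost_def sum.distrib)
qed

lemma cost_split_ge:
  assumes i: "i \<in> S - {r}" and M: "M \<subseteq> A"
  shows "(\<Sum>j\<in>M. fibre_cost i j) + card {p \<in> Z. p i \<notin> M} + card {p \<in> X. p \<circ> transpose r i \<in> Y}
    \<le> cost S r A f X Y"
proof -
  have "card {p \<in> Z. p i \<notin> M} = (\<Sum>j\<in>A - M. card (fibre {p \<in> Z. p i \<notin> M} i j))"
    using finite_V fin i symbol_in by (intro card_eq_sum_fibres) auto
  also have "\<dots> \<le> (\<Sum>j\<in>A - M. fibre_cost i j)"
  proof (rule sum_mono)
    fix j assume j: "j \<in> A - M"
    then have "fibre V i j = arrangements (S - {i}) (A - {j}) (f(i := j))"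
      using i by (intro fibre_arrangements) auto
    then have "fibre {p \<in> Z. p i \<notin> M} i j
        = arrangements (S - {i}) (A - {j}) (f(i := j)) - (fibre X i j \<union> fibre Y i j)"
      using j by (auto simp: fibre_def)
    then show "card (fibre {p \<in> Z. p i \<notin> M} i j) \<le> fibre_cost i j"
      by (simp add: cost_def)
  qed
  finally show ?thesis
    using cost_split[OF i] sum.subset_diff[OF M fin(2), of "fibre_cost i"] by simp
qed

end

section \<open>A set of large minimum degree spreads over some position\<close>

text \<open>
  Double counting. Let \<open>R\<close> be the part of \<open>X\<close> reachable from some \<open>x\<^sub>0\<close>, let \<open>H\<close> be the symbols that reach
  the centre within \<open>R\<close>, and \<open>I\<close> the other positions that hold a symbol of \<open>H\<close> in \<open>x\<^sub>0\<close>. A symbol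
  outside \<open>H\<close> never moves, so \<open>card H = card I + 1\<close> and all movement is within \<open>I\<close>. When a symbol
  of \<open>H\<close> is in the centre, at least \<open>k\<close> moves put it into \<open>k\<close> different positions of \<open>I\<close>. Hence there are at
  least \<open>k * card H\<close> pairs of a position of \<open>I\<close> and a symbol seen there, which exceeds
  \<open>k * card I\<close> if \<open>k > 0\<close>.
\<close>

lemma exists_spread_position:
  assumes "finite S" "r \<in> S" and "2 \<le> card S"
    and X: "X \<subseteq> arrangements S A f" and "X \<noteq> {}"
    and finA: "finite A"
    and deg: "\<And>p. p \<in> X \<Longrightarrow> k \<le> card (moves S r X p)"
  shows "\<exists>i \<in> S - {r}. k + 1 \<le> card ((\<lambda>p. p i) ` X)"
proof (rule ccontr)
  assume "\<not> ?thesis"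
  then have small: "card ((\<lambda>p. p i) ` X) \<le> k" if "i \<in> S - {r}" for i
    using that by force
  obtain x\<^sub>0 where x0: "x\<^sub>0 \<in> X" using \<open>X \<noteq> {}\<close> by blast
  define step where "step = {(p, p \<circ> transpose r i) | p i. i \<in> moves S r X p}"
  define R where "R = {p. (x\<^sub>0, p) \<in> step\<^sup>*}"
  define H where "H = (\<lambda>p. p r) ` R"
  define I where "I = {i \<in> S - {r}. x\<^sub>0 i \<in> H}"
  define C where "C = (\<lambda>i. (\<lambda>p. p i) ` X)"
  have finX: "finite ((\<lambda>p. p i) ` X)" if "i \<in> S" for i
  proof (rule finite_subset[OF _ finA])
    show "(\<lambda>p. p i) ` X \<subseteq> A" using arrangements_apply[OF subsetD[OF X] that] by auto
  qed
  have R_X: "p \<in> X" if "p \<in> R" for p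
    using that x0 unfolding R_def mem_Collect_eq
    by (induction rule: rtrancl_induct) (auto simp: step_def moves_def)
  have R_step: "p \<circ> transpose r i \<in> R" if "p \<in> R" "i \<in> moves S r X p" for p i
    using that unfolding R_def step_def by (auto intro: rtrancl_into_rtrancl)
  have x0R: "x\<^sub>0 \<in> R" by (simp add: R_def)
  \<comment> \<open>Only a symbol of \<open>H\<close> can be moved: to leave its position it must pass through the centre.\<close>
  have fixed: "p i = x\<^sub>0 i" if "p \<in> R" "i \<in> S - {r}" "x\<^sub>0 i \<notin> H" for p i
    using that(1) unfolding R_def mem_Collect_eq
  proof (induction rule: rtrancl_induct)
    case (step p q)
    then obtain l where l: "l \<in> moves S r X p" "q = p \<circ> transpose r l"
      by (auto simp: step_def)
    have "l \<noteq> i"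
    proof
      assume "l = i"
      then have "q r = x\<^sub>0 i" using l step.IH by simp
      moreover have "q \<in> R" using step.hyps by (auto simp: R_def)
      ultimately show False using that(3) imageI[of q R "\<lambda>p. p r"] by (simp add: H_def)
    qed
    then show ?case using l(2) that(2) step.IH by simp
  qed simp
  have finI: "finite I" using \<open>finite S\<close> by (simp add: I_def)
  have HA: "H \<subseteq> A" using arrangements_apply[OF subsetD[OF X R_X] \<open>r \<in> S\<close>] by (auto simp: H_def)
  have finH: "finite H" using HA finA by (rule finite_subset)
  have x0_bij: "bij_betw x\<^sub>0 S A" using x0 X by (auto simp: arrangements_def)
  have "x\<^sub>0 ` insert r I = H"
  proof -
    have "x\<^sub>0 r \<in> H" using x0R by (simp add: H_def)
    moreover have "s \<in> x\<^sub>0 ` insert r I" if s: "s \<in> H" for s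
    proof -
      have "s \<in> x\<^sub>0 ` S" using bij_betw_imp_surj_on[OF x0_bij] s HA by blast
      then obtain i where "i \<in> S" "x\<^sub>0 i = s" by blast
      then show ?thesis using s by (cases "i = r") (auto simp: I_def)
    qed
    ultimately show ?thesis by (auto simp: I_def)
  qed
  moreover have "inj_on x\<^sub>0 (insert r I)"
    using \<open>r \<in> S\<close> by (intro inj_on_subset[OF bij_betw_imp_inj_on[OF x0_bij]]) (auto simp: I_def)
  ultimately have "card H = card (insert r I)" by (metis card_image)
  then have card_H: "card H = Suc (card I)" using finI by (simp add: I_def)
  \<comment> \<open>A position outside \<open>I\<close> holds a fixed symbol not in \<open>H\<close>, so the moves of \<open>s\<close> lead into \<open>I\<close>.\<close>
  have ge: "k \<le> card {i \<in> I. s \<in> C i}" if "s \<in> H" for s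
  proof -
    obtain p where p: "p \<in> R" "p r = s" using \<open>s \<in> H\<close> by (auto simp: H_def)
    have "moves S r X p \<subseteq> {i \<in> I. s \<in> C i}"
    proof
      fix i assume i: "i \<in> moves S r X p"
      have s: "(p \<circ> transpose r i) i = s" using p by simp
      have "i \<in> I"
      proof (rule ccontr)
        assume "i \<notin> I"
        have iS: "i \<in> S - {r}" using i unfolding moves_def by blast
        with \<open>i \<notin> I\<close> have x0i: "x\<^sub>0 i \<notin> H" unfolding I_def by blast
        have "s = x\<^sub>0 i" using fixed[OF R_step[OF p(1) i] iS x0i] unfolding s .
        with \<open>s \<in> H\<close> x0i show False by simp
      qed
      moreover have "s \<in> C i"
        unfolding C_def s[symmetric] using R_X[OF R_step[OF p(1) i]] by (rule imageI)
      ultimately show "i \<in> {i \<in> I. s \<in> C i}" by simp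
    qed
    then have "card (moves S r X p) \<le> card {i \<in> I. s \<in> C i}"
      by (rule card_mono[rotated]) (rule finite_subset[OF _ finI], blast)
    moreover have "k \<le> card (moves S r X p)" by (rule deg[OF R_X[OF p(1)]])
    ultimately show ?thesis by (rule le_trans[rotated])
  qed
  have "k * card H \<le> (\<Sum>s\<in>H. card {i \<in> I. s \<in> C i})"
    using sum_bounded_below[of H k] ge by (simp add: mult.commute)
  also have "\<dots> = (\<Sum>s\<in>H. \<Sum>i | i \<in> I \<and> s \<in> C i. 1)" by simp
  also have "\<dots> = (\<Sum>i\<in>I. \<Sum>s | s \<in> H \<and> s \<in> C i. 1)"
    using finH finI by (rule sum.swap_restrict)
  also have "\<dots> \<le> (\<Sum>i\<in>I. k)"
  proof (rule sum_mono)
    fix i assume "i \<in> I"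
    then have i: "i \<in> S - {r}" by (simp add: I_def)
    have "card {s. s \<in> H \<and> s \<in> C i} \<le> card (C i)"
      using finX[of i] i by (intro card_mono) (auto simp: C_def)
    then show "(\<Sum>s | s \<in> H \<and> s \<in> C i. 1) \<le> k"
      using small[OF i] by (simp add: C_def)
  qed
  finally have "k = 0" using card_H by simp
  have "card (S - {r}) \<noteq> 0" using \<open>2 \<le> card S\<close> \<open>r \<in> S\<close> by (simp add: card_Diff_singleton)
  then have "S - {r} \<noteq> {}" by (metis card.empty)
  then obtain i where "i \<in> S - {r}" by blast
  then have "card ((\<lambda>p. p i) ` X) = 0" "finite ((\<lambda>p. p i) ` X)"
    using small[of i] finX[of i] \<open>k = 0\<close> by auto
  then show False using \<open>X \<noteq> {}\<close> by simp
qed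

section \<open>Mixed and pure fibres\<close>

context disjoint_pair
begin

text \<open>
  The exchange along \<open>i\<close> matches the vertices with a symbol of \<open>P\<close> in position \<open>i\<close> and one of \<open>Q\<close>
  in the centre with those where \<open>P\<close> and \<open>Q\<close> are interchanged. In a matched pair the first vertex
  is not in \<open>Y\<close> and the second not in \<open>X\<close>, so one of them is outside \<open>X \<union> Y\<close> or they form an
  edge between \<open>X\<close> and \<open>Y\<close>.
\<close>

lemma card_pure_fibres_le:
  assumes i: "i \<in> S - {r}" and PQ: "P \<subseteq> A" "Q \<subseteq> A" "P \<inter> Q = {}" 
    and P: "\<And>j. j \<in> P \<Longrightarrow> fibre Y i j = {}" and Q: "\<And>j. j \<in> Q \<Longrightarrow> fibre X i j = {}"
  shows "card P * card Q * fact (card S - 2)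
    \<le> card {p \<in> Z. p i \<in> P \<union> Q} + card {p \<in> X. p \<circ> transpose r i \<in> Y}"
proof -
  let ?W = "{p \<in> V. (p i, p r) \<in> P \<times> Q}"
  let ?ZP = "{p \<in> Z. p i \<in> P}" and ?ZQ = "{p \<in> Z. p i \<in> Q}"
  let ?E = "{p \<in> X. p \<circ> transpose r i \<in> Y}"
  have fins: "finite ?ZP" "finite ?ZQ" "finite ?E"
    using finite_V finite_XY by auto
  have "card ?W = card (P \<times> Q) * fact (card S - 2)"
    using fin card_eq root i PQ by (intro card_two_values) auto
  then have "card P * card Q * fact (card S - 2) = card ?W"
    by (simp add: card_cartesian_product)
  also have "\<dots> \<le> card (?ZP \<union> (\<lambda>p. p \<circ> transpose r i) ` ?ZQ \<union> ?E)"
  proof (rule card_mono)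
    show "finite (?ZP \<union> (\<lambda>p. p \<circ> transpose r i) ` ?ZQ \<union> ?E)" using fins by blast
    show "?W \<subseteq> ?ZP \<union> (\<lambda>p. p \<circ> transpose r i) ` ?ZQ \<union> ?E"
    proof
      fix p assume "p \<in> ?W"
      then have p: "p \<in> V" "p i \<in> P" "p r \<in> Q" by auto
      define q where "q = p \<circ> transpose r i"
      have q: "q \<in> V" "q i \<in> Q" and pq: "p = q \<circ> transpose r i"
        using p move_closed i by (simp_all add: q_def)
      have "p \<notin> Y" "q \<notin> X" using P[OF p(2)] Q[OF q(2)] p q by (auto simp: fibre_def)
      then consider "p \<in> ?ZP" | "q \<in> ?ZQ" | "p \<in> X" "q \<in> Y" using p q by blast
      then show "p \<in> ?ZP \<union> (\<lambda>p. p \<circ> transpose r i) ` ?ZQ \<union> ?E"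
      proof cases
        case 2
        then show ?thesis using pq by blast
      qed (simp_all add: q_def)
    qed
  qed
  also have "\<dots> \<le> card ?ZP + card ?ZQ + card ?E"
    using card_image_le[OF fins(2), of "\<lambda>p. p \<circ> transpose r i"]
      card_Un_le[of "?ZP \<union> (\<lambda>p. p \<circ> transpose r i) ` ?ZQ" ?E]
      card_Un_le[of ?ZP "(\<lambda>p. p \<circ> transpose r i) ` ?ZQ"] by linarith
  also have "card ?ZP + card ?ZQ = card (?ZP \<union> ?ZQ)"
    using fins PQ by (intro card_Un_disjoint[symmetric]) auto
  also have "?ZP \<union> ?ZQ = {p \<in> Z. p i \<in> P \<union> Q}" by auto
  finally show ?thesis .
qed

definition mixed :: "'a \<Rightarrow> 'b set" where
  "mixed i = {j \<in> A. fibre X i j \<noteq> {} \<and> fibre Y i j \<noteq> {}}"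

text \<open>
  A fibre that meets neither \<open>X\<close> nor \<open>Y\<close> is counted as \<open>X_pure\<close>, so that the three classes partition
  the symbols.
\<close>

definition X_pure :: "'a \<Rightarrow> 'b set" where
  "X_pure i = {j \<in> A. fibre Y i j = {}}"

definition Y_pure :: "'a \<Rightarrow> 'b set" where
  "Y_pure i = {j \<in> A. fibre X i j = {} \<and> fibre Y i j \<noteq> {}}"

lemma finite_symbol_classes: "finite (mixed i)" "finite (X_pure i)" "finite (Y_pure i)"
  using fin by (auto simp: mixed_def X_pure_def Y_pure_def)

lemma card_symbol_classes: "card (mixed i) + card (X_pure i) + card (Y_pure i) = card S"
proof -
  have "card (mixed i \<union> X_pure i \<union> Y_pure i) = card (mixed i) + card (X_pure i) + card (Y_pure i)"
    using fin by (subst card_Un_disjoint card_Un_disjoint;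
        auto simp: mixed_def X_pure_def Y_pure_def)+
  moreover have "mixed i \<union> X_pure i \<union> Y_pure i = A"
    by (auto simp: mixed_def X_pure_def Y_pure_def)
  ultimately show ?thesis using card_eq by simp
qed

lemma cost_ge_mixed_pure:
  assumes i: "i \<in> S - {r}"
  shows "(\<Sum>j\<in>mixed i. fibre_cost i j) + card (X_pure i) * card (Y_pure i) * fact (card S - 2)
    \<le> cost S r A f X Y"
proof -
  have "card (X_pure i) * card (Y_pure i) * fact (card S - 2)
    \<le> card {p \<in> Z. p i \<in> X_pure i \<union> Y_pure i} + card {p \<in> X. p \<circ> transpose r i \<in> Y}"
    using i by (intro card_pure_fibres_le) (auto simp: X_pure_def Y_pure_def)
  moreover have "card {p \<in> Z. p i \<in> X_pure i \<union> Y_pure i} \<le> card {p \<in> Z. p i \<notin> mixed i}"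
    using finite_V by (intro card_mono) (auto simp: X_pure_def Y_pure_def mixed_def)
  ultimately show ?thesis
    using cost_split_ge[OF i, of "mixed i"] by (force simp: mixed_def)
qed

text \<open>
  If \<open>X\<close> is confined at position \<open>i\<close> and \<open>Y\<close> at position \<open>l\<close>, every vertex that avoids \<open>mixed i\<close> at \<open>i\<close>
  and \<open>M\<close> at \<open>l\<close> is outside \<open>X \<union> Y\<close>. The second symbol must differ from the first one, hence the term \<open>- 1\<close>.
\<close>

lemma cost_ge_confined:
  assumes i: "i \<in> S - {r}" and l: "l \<in> S - {r}" and "i \<noteq> l"
    and X: "\<And>p. p \<in> X \<Longrightarrow> p i \<in> mixed i" and Y: "\<And>p. p \<in> Y \<Longrightarrow> p l \<in> M" and M: "M \<subseteq> A"
  shows "(\<Sum>j\<in>mixed i. fibre_cost i j)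
      + (card S - card (mixed i)) * (card S - card M - 1) * fact (card S - 2) \<le> cost S r A f X Y"
proof -
  let ?B = "\<lambda>j. A - M - {j}"
  let ?Q = "SIGMA j:A - mixed i. ?B j"
  have mixA: "mixed i \<subseteq> A" by (auto simp: mixed_def)
  have finM: "finite (mixed i)" "finite M" using finite_symbol_classes M fin(2) finite_subset by blast+
  have B: "card S - card M - 1 \<le> card (?B j)" for j
    using card_Diff_subset[OF finM(2) M] card_eq by (auto simp: card_Diff_singleton_if)
  have "(card S - card (mixed i)) * (card S - card M - 1) = (\<Sum>j\<in>A - mixed i. card S - card M - 1)"
    using card_Diff_subset[OF finM(1) mixA] card_eq by simp
  also have "\<dots> \<le> (\<Sum>j\<in>A - mixed i. card (?B j))"
    using B by (rule sum_mono)
  also have "\<dots> = card ?Q"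
    using fin by (intro card_SigmaI[symmetric]) auto
  finally have "(card S - card (mixed i)) * (card S - card M - 1) * fact (card S - 2)
      \<le> card ?Q * fact (card S - 2)"
    by (rule mult_le_mono1)
  also have "\<dots> = card {p \<in> V. (p i, p l) \<in> ?Q}"
    using fin card_eq i l \<open>i \<noteq> l\<close> by (intro card_two_values[symmetric]) auto
  also have "\<dots> \<le> card {p \<in> Z. p i \<notin> mixed i}"
    using X Y finite_V by (intro card_mono) auto
  finally show ?thesis using cost_split_ge[OF i mixA] by linarith
qed

lemma moves_fibre:
  assumes i: "i \<in> S - {r}" and p: "p \<in> fibre W i j"
  shows "card (moves S r W p) - 1 \<le> card (moves (S - {i}) r (fibre W i j) p)"
proof -
  have "moves S r W p - {i} \<subseteq> moves (S - {i}) r (fibre W i j) p"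
    using assms by (auto simp: moves_def fibre_def)
  then have "card (moves S r W p - {i}) \<le> card (moves (S - {i}) r (fibre W i j) p)"
    using fin by (intro card_mono) (auto simp: moves_def)
  then show ?thesis by (simp add: card_Diff_singleton_if split: if_splits)
qed

end

section \<open>The lower bound for disjoint pairs\<close>

lemma (in disjoint_pair) two_le_card:
  assumes "X \<noteq> {}" and "Y \<noteq> {}"
  shows "2 \<le> card S"
proof -
  obtain x y where xy: "x \<in> X" "y \<in> Y" using assms by blast
  then have "x \<noteq> y" using disj by blast
  then have "card {x, y} \<le> card V" using xy sub finite_V by (intro card_mono) auto
  then have "2 \<le> (fact (card S) :: nat)" using \<open>x \<noteq> y\<close> card_V by simp
  show ?thesis
  proof (rule ccontr)
    assume "\<not> ?thesis"
    then have "card S = 0 \<or> card S = 1" by linarith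
    then show False using \<open>2 \<le> (fact (card S) :: nat)\<close> by auto
  qed
qed

lemma mult_ge_add_pred:
  fixes a b :: nat
  assumes "1 \<le> a" and "1 \<le> b"
  shows "a + b - 1 \<le> a * b"
proof -
  obtain a' b' where "a = Suc a'" "b = Suc b'" using assms by (metis Suc_le_D One_nat_def)
  then show ?thesis by simp
qed

text \<open>
  The start \<open>k = 0\<close>, where no degrees are assumed. By induction on the number of positions two mixed
  fibres are enough, and a single mixed fibre \<open>j\<close> falls short by one. The missing unit comes from
  two pure fibres of different kind or, if all of \<open>X\<close> or all of \<open>Y\<close> lies in the fibre \<open>j\<close>, from
  a neighbour outside that fibre.
\<close>

lemma cost_ge_degree:
  assumes "disjoint_pair S r A f X Y" and "X \<noteq> {}" and "Y \<noteq> {}"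
  shows "card S - 1 \<le> cost S r A f X Y"
  using assms
proof (induction "card S" arbitrary: S A f X Y rule: less_induct)
  case less
  interpret disjoint_pair S r A f X Y by fact
  have two: "2 \<le> card S" using two_le_card less.prems by blast
  have "S - {r} \<noteq> {}"
    using two root fin card_Diff_singleton[of r S]
    by (metis card.empty Suc_1 diff_is_0_eq not_less_eq_eq One_nat_def)
  then obtain i where i: "i \<in> S - {r}" by blast
  have IH: "card S - 2 \<le> fibre_cost i j \<and> 3 \<le> card S" if "j \<in> mixed i" for j
  proof -
    have j: "j \<in> A" "fibre X i j \<noteq> {}" "fibre Y i j \<noteq> {}" using that by (auto simp: mixed_def)
    have "card (S - {i}) = card S - 1" using i fin by simp
    then show ?thesis
      using less.hyps[OF _ fibre_pair[OF i j(1)] j(2,3)] two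
        disjoint_pair.two_le_card[OF fibre_pair[OF i j(1)] j(2,3)] by (auto simp: numeral_2_eq_2)
  qed
  obtain x y where xy: "x \<in> X" "y \<in> Y" using less.prems by blast
  have xi: "x i \<in> mixed i \<or> x i \<in> X_pure i" and yi: "y i \<in> mixed i \<or> y i \<in> Y_pure i"
    using xy symbol_in sub i by (auto simp: mixed_def X_pure_def Y_pure_def fibre_def)
  have prod: "card (X_pure i) + card (Y_pure i) - 1 \<le> card (X_pure i) * card (Y_pure i) * fact (card S - 2)"
    if "X_pure i \<noteq> {}" "Y_pure i \<noteq> {}"
  proof -
    have "1 \<le> card (X_pure i)" "1 \<le> card (Y_pure i)"
      using that finite_symbol_classes by (simp_all add: Suc_le_eq card_gt_0_iff)
    then have "card (X_pure i) + card (Y_pure i) - 1 \<le> card (X_pure i) * card (Y_pure i)"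
      by (rule mult_ge_add_pred)
    also have "\<dots> \<le> card (X_pure i) * card (Y_pure i) * fact (card S - 2)" by simp
    finally show ?thesis .
  qed
  consider "mixed i = {}" | j where "mixed i = {j}" | "2 \<le> card (mixed i)"
    using finite_symbol_classes(1)[of i]
    by (metis One_nat_def Suc_1 card_0_eq card_1_singletonE le_antisym not_less_eq_eq le0)
  then show ?case
  proof cases
    case 1
    then have "X_pure i \<noteq> {}" "Y_pure i \<noteq> {}" using xi yi by auto
    then show ?thesis using prod cost_ge_mixed_pure[OF i] card_symbol_classes[of i] 1 by simp
  next
    case 3
    then obtain j where "j \<in> mixed i" by fastforce
    then have "3 \<le> card S" using IH by blast
    have "2 * (card S - 2) \<le> card (mixed i) * (card S - 2)" using 3 by (rule mult_le_mono1)
    also have "\<dots> \<le> (\<Sum>j\<in>mixed i. fibre_cost i j)"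
      using sum_bounded_below[of "mixed i" "card S - 2" "fibre_cost i"] IH by simp
    finally show ?thesis using cost_ge_mixed_pure[OF i] \<open>3 \<le> card S\<close> by linarith
  next
    case (2 j)
    have fc: "card S - 2 \<le> fibre_cost i j" using IH 2 by blast
    show ?thesis
    proof (cases "X_pure i \<noteq> {} \<and> Y_pure i \<noteq> {}")
      case True
      then have "1 \<le> card (X_pure i) + card (Y_pure i) - 1"
        using finite_symbol_classes[of i]
        by (metis One_nat_def Suc_leI add_diff_cancel_right' add_gr_0 card_gt_0_iff diff_Suc_1
            Suc_pred add_Suc_right)
      then show ?thesis using prod True cost_ge_mixed_pure[OF i] fc 2 by simp
    next
      case False
      \<comment> \<open>A vertex of the set that lies in the fibre \<open>j\<close>; its neighbour \<open>q\<close> is in another fibre.\<close>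
      define z where "z = (if X_pure i = {} then x else y)"
      define q where "q = z \<circ> transpose r i"
      have z: "z \<in> V" "z i = j" using False xi yi 2 xy sub by (auto simp: z_def)
      have q: "q \<in> V" "q i \<noteq> j" and zq: "z = q \<circ> transpose r i"
        using z move_closed symbol_inj[OF z(1), of r i] i root by (auto simp: q_def)
      have Xj: "p i = j" if "X_pure i = {}" "p \<in> X" for p
        using that 2 symbol_in[of p i] sub i by (auto simp: mixed_def X_pure_def fibre_def)
      have Yj: "p i = j" if "Y_pure i = {}" "p \<in> Y" for p
        using that 2 symbol_in[of p i] sub i by (auto simp: mixed_def Y_pure_def fibre_def)
      have "q \<in> {p \<in> Z. p i \<notin> {j}} \<or> {p \<in> X. p \<circ> transpose r i \<in> Y} \<noteq> {}"
      proof (cases "X_pure i = {}")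
        case True
        then have "q \<notin> X" "q = x \<circ> transpose r i" using Xj q(2) by (auto simp: z_def q_def)
        then show ?thesis using q(1,2) xy(1) by blast
      next
        case pure: False
        then have "q \<notin> Y" "y = q \<circ> transpose r i" using Yj q(2) False zq by (auto simp: z_def)
        then show ?thesis using q xy(2) by blast
      qed
      then have "1 \<le> card {p \<in> Z. p i \<notin> {j}} + card {p \<in> X. p \<circ> transpose r i \<in> Y}"
        using finite_V finite_XY by (auto simp: Suc_le_eq card_gt_0_iff)
      moreover have "fibre_cost i j + card {p \<in> Z. p i \<notin> {j}} + card {p \<in> X. p \<circ> transpose r i \<in> Y}
          \<le> cost S r A f X Y"
      proof -
        have "{j} \<subseteq> A" using 2 by (auto simp: mixed_def)
        from cost_split_ge[OF i this] show ?thesis by simp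
      qed
      ultimately show ?thesis using fc by linarith
    qed
  qed
qed

text \<open>
  Here \<open>m\<close>, \<open>a\<close> and \<open>b\<close> are the numbers of mixed fibres and of pure fibres of either kind. For
  \<open>d \<ge> 2\<close> the pure fibres suffice, as \<open>a * b \<ge> d\<close> and \<open>(n - 2)! \<ge> (K + 1)!\<close>; for \<open>d = 1\<close> only
  \<open>(n - 2)! = K!\<close>, and the mixed fibres make up the difference.
\<close>

lemma fact_le_both_pure:
  fixes K d n m a b :: nat
  assumes n: "n = K + 1 + d" "m + a + b = n" and "m \<le> K" "1 \<le> a" "1 \<le> b" "1 \<le> d"
  shows "fact (K + 1) * d \<le> m * (fact K * d) + a * b * fact (n - 2)"
proof -
  have ab: "K + d - m \<le> a * b" using mult_ge_add_pred[of a b] assms by linarith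
  show ?thesis
  proof (cases "d = 1")
    case True
    then have "K + 1 \<le> m + a * b" "n - 2 = K" using ab assms by auto
    then have "(K + 1) * fact K \<le> (m + a * b) * fact K" by (intro mult_le_mono1)
    then show ?thesis using True \<open>n - 2 = K\<close> by (simp add: algebra_simps)
  next
    case False
    then have "fact (K + 1) \<le> (fact (n - 2) :: nat)" using assms by (intro fact_mono) auto
    moreover have "d \<le> a * b" using ab assms by linarith
    ultimately have "fact (K + 1) * d \<le> fact (n - 2) * (a * b)" by (intro mult_le_mono)
    then show ?thesis by (simp add: mult.commute)
  qed
qed

lemma fact_le_confined:
  fixes K d n m m' :: nat
  assumes n: "n = K + 1 + d" and "m \<le> K" "m' \<le> K" "1 \<le> d"
  shows "fact (K + 1) * d \<le> m * (fact K * d) + (n - m) * (n - m' - 1) * fact (n - 2)"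
proof -
  have "fact (K + 1) * d \<le> n * (fact K * d)"
  proof -
    have "(K + 1) * (fact K * d) \<le> n * (fact K * d)" using n by (intro mult_le_mono1) simp
    then show ?thesis by (simp add: algebra_simps)
  qed
  also have "\<dots> = m * (fact K * d) + (n - m) * (d * fact K)"
  proof -
    have "n = m + (n - m)" using assms by simp
    then have "n * (fact K * d) = (m + (n - m)) * (fact K * d)" by simp
    then show ?thesis by (simp only: distrib_right mult.commute[of d])
  qed
  also have "(n - m) * (d * fact K) \<le> (n - m) * ((n - m' - 1) * fact (n - 2))"
    using assms by (intro mult_le_mono fact_mono) auto
  finally show ?thesis by (simp add: mult.assoc)
qed

text \<open>
  The induction is on \<open>k\<close>, for all star graphs at once. In the step, too small a cost
  would leave each position with at most \<open>k\<close> mixed fibres and with pure fibres of one kind only.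
  A position where \<open>Y\<close> spreads and one where \<open>X\<close> spreads would then satisfy \<open>cost_ge_confined\<close>.
\<close>

theorem cost_ge_fact:
  assumes "disjoint_pair S r A f X Y" and "X \<noteq> {}" and "Y \<noteq> {}"
    and "\<And>p. p \<in> X \<Longrightarrow> k \<le> card (moves S r X p)"
    and "\<And>p. p \<in> Y \<Longrightarrow> k \<le> card (moves S r Y p)"
    and "k + 2 \<le> card S"
  shows "fact (k + 1) * (card S - k - 1) \<le> cost S r A f X Y"
  using assms
proof (induction k arbitrary: S A f X Y)
  case 0
  then show ?case using cost_ge_degree by fastforce
next
  case (Suc k)
  interpret disjoint_pair S r A f X Y by fact
  let ?K = "Suc k"
  define d where "d = card S - ?K - 1"
  have n: "card S = ?K + 1 + d" "1 \<le> d" using Suc.prems(6) by (simp_all add: d_def)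
  have mix: "card (mixed i) * (fact ?K * d) \<le> (\<Sum>j\<in>mixed i. fibre_cost i j)"
    if i: "i \<in> S - {r}" for i
  proof -
    have "fact ?K * d \<le> fibre_cost i j" if "j \<in> mixed i" for j
    proof -
      have j: "j \<in> A" "fibre X i j \<noteq> {}" "fibre Y i j \<noteq> {}" using that by (auto simp: mixed_def)
      have c: "card (S - {i}) = card S - 1" using i fin by simp
      have "fact (k + 1) * (card (S - {i}) - k - 1) \<le> fibre_cost i j"
      proof (rule Suc.IH[OF fibre_pair[OF i j(1)] j(2,3)])
        show "k \<le> card (moves (S - {i}) r (fibre X i j) p)" if "p \<in> fibre X i j" for p
          using Suc.prems(4)[of p] moves_fibre[OF i that] that by (simp add: fibre_def)
        show "k \<le> card (moves (S - {i}) r (fibre Y i j) p)" if "p \<in> fibre Y i j" for p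
          using Suc.prems(5)[of p] moves_fibre[OF i that] that by (simp add: fibre_def)
        show "k + 2 \<le> card (S - {i})" using c Suc.prems(6) by simp
      qed
      then show ?thesis using c n by simp
    qed
    then show ?thesis
      using sum_bounded_below[of "mixed i" "fact ?K * d" "fibre_cost i"] by simp
  qed
  have goal: "fact (?K + 1) * d \<le> cost S r A f X Y"
  proof (rule ccontr)
    assume neg: "\<not> ?thesis"
    have few: "card (mixed i) \<le> ?K" if i: "i \<in> S - {r}" for i
    proof (rule ccontr)
      assume "\<not> ?thesis"
      then have "(?K + 1) * (fact ?K * d) \<le> card (mixed i) * (fact ?K * d)"
        by (intro mult_le_mono1) simp
      then have "fact (?K + 1) * d \<le> card (mixed i) * (fact ?K * d)"
        by (simp only: fact_Suc Suc_eq_plus1[symmetric] of_nat_id mult.assoc)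
      then show False using neg mix[OF i] cost_ge_mixed_pure[OF i] by linarith
    qed
    have one_sided: "X_pure i = {} \<or> Y_pure i = {}" if i: "i \<in> S - {r}" for i
    proof (rule ccontr)
      assume "\<not> ?thesis"
      then have "1 \<le> card (X_pure i)" "1 \<le> card (Y_pure i)"
        using finite_symbol_classes by (simp_all add: Suc_le_eq card_gt_0_iff)
      then have "fact (?K + 1) * d
          \<le> card (mixed i) * (fact ?K * d) + card (X_pure i) * card (Y_pure i) * fact (card S - 2)"
        using n few[OF i] card_symbol_classes[of i] by (intro fact_le_both_pure)
      then show False using neg mix[OF i] cost_ge_mixed_pure[OF i] by linarith
    qed
    have two: "2 \<le> card S" using n by simp
    \<comment> \<open>\<open>Y\<close> meets more fibres than can be mixed, so some are pure and \<open>X\<close> is confined at \<open>i\<close>.\<close>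
    obtain i where i: "i \<in> S - {r}" "?K + 1 \<le> card ((\<lambda>p. p i) ` Y)"
      using exists_spread_position[OF fin(1) root two sub(2) Suc.prems(3) fin(2) Suc.prems(5)] by blast
    have "(\<lambda>p. p i) ` Y \<subseteq> mixed i \<union> Y_pure i"
      using symbol_in sub i by (auto simp: mixed_def Y_pure_def fibre_def)
    then have "Y_pure i \<noteq> {}"
      using i few[OF i(1)] card_mono[OF finite_symbol_classes(1), of "(\<lambda>p. p i) ` Y" i] by auto
    then have Xi: "X_pure i = {}" using one_sided i by blast
    \<comment> \<open>By the same argument with the roles exchanged, \<open>Y\<close> is confined at \<open>l\<close>.\<close>
    obtain l where l: "l \<in> S - {r}" "?K + 1 \<le> card ((\<lambda>p. p l) ` X)"
      using exists_spread_position[OF fin(1) root two sub(1) Suc.prems(2) fin(2) Suc.prems(4)] by blast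
    have "(\<lambda>p. p l) ` X \<subseteq> mixed l \<union> X_pure l"
      using symbol_in sub l by (auto simp: mixed_def X_pure_def fibre_def)
    then have "X_pure l \<noteq> {}"
      using l few[OF l(1)] card_mono[OF finite_symbol_classes(1), of "(\<lambda>p. p l) ` X" l] by auto
    then have Yl: "Y_pure l = {}" and "i \<noteq> l" using one_sided l Xi by auto
    have "p i \<in> mixed i" if "p \<in> X" for p
      using that Xi symbol_in[of p i] sub i by (auto simp: mixed_def X_pure_def fibre_def)
    moreover have "p l \<in> mixed l" if "p \<in> Y" for p
      using that Yl symbol_in[of p l] sub l by (auto simp: mixed_def Y_pure_def fibre_def)
    moreover have "mixed l \<subseteq> A" by (auto simp: mixed_def)
    ultimately have "(\<Sum>j\<in>mixed i. fibre_cost i j)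
        + (card S - card (mixed i)) * (card S - card (mixed l) - 1) * fact (card S - 2)
        \<le> cost S r A f X Y"
      using i l \<open>i \<noteq> l\<close> by (intro cost_ge_confined) auto
    moreover have "fact (?K + 1) * d \<le> card (mixed i) * (fact ?K * d)
        + (card S - card (mixed i)) * (card S - card (mixed l) - 1) * fact (card S - 2)"
      using n few i l by (intro fact_le_confined) auto
    ultimately show False using neg mix[OF i(1)] by linarith
  qed
  then show ?case by (simp only: d_def)
qed

section \<open>Cuts of the star graph in terms of exchanges\<close>

lemma disconnected_iff:
  assumes "wf_digraph G"
  shows "disconnected G \<longleftrightarrow>
    (\<exists>X \<subseteq> verts G. X \<noteq> {} \<and> X \<noteq> verts G \<and> (\<forall>e \<in> arcs G. tail G e \<in> X \<longleftrightarrow> head G e \<in> X))"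
proof -
  interpret wf_digraph G by fact
  let ?R = "rtrancl_on (verts G) ((arcs_ends G)\<^sup>s)"
  have ends: "(tail G e, head G e) \<in> (arcs_ends G)\<^sup>s" "(head G e, tail G e) \<in> (arcs_ends G)\<^sup>s"
    if "e \<in> arcs G" for e
    using that by (auto simp: arcs_ends_conv symcl_def)
  show ?thesis
  proof
    assume "disconnected G"
    then obtain u v where uv: "u \<in> verts G" "v \<in> verts G" "(u, v) \<notin> ?R"
      by (auto simp: disconnected_def connected_conv)
    let ?X = "{w. (u, w) \<in> ?R}"
    have "?X \<subseteq> verts G" by (auto dest: in_rtrancl_on_in_F)
    moreover have "u \<in> ?X" "v \<notin> ?X" using uv by auto
    moreover have "tail G e \<in> ?X \<longleftrightarrow> head G e \<in> ?X" if e: "e \<in> arcs G" for e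
      using ends[OF e] tail_in_verts[OF e] head_in_verts[OF e]
      by (auto intro: rtrancl_on_into_rtrancl_on)
    ultimately show "\<exists>X \<subseteq> verts G. X \<noteq> {} \<and> X \<noteq> verts G \<and> (\<forall>e \<in> arcs G. tail G e \<in> X \<longleftrightarrow> head G e \<in> X)"
      using uv by (intro exI[of _ ?X]) blast
  next
    assume "\<exists>X \<subseteq> verts G. X \<noteq> {} \<and> X \<noteq> verts G \<and> (\<forall>e \<in> arcs G. tail G e \<in> X \<longleftrightarrow> head G e \<in> X)"
    then obtain X where X: "X \<subseteq> verts G" "X \<noteq> {}" "X \<noteq> verts G"
      and closed: "\<And>e. e \<in> arcs G \<Longrightarrow> tail G e \<in> X \<longleftrightarrow> head G e \<in> X" by blast
    obtain u v where uv: "u \<in> X" "v \<in> verts G" "v \<notin> X" using X by blast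
    have "w \<in> X" if "(u, w) \<in> ?R" for w
      using that
    proof (induction rule: rtrancl_on_induct)
      case (step y z)
      then show ?case using closed by (auto simp: arcs_ends_conv symcl_def)
    qed (rule uv)
    then have "(u, v) \<notin> ?R" using uv by blast
    then show "disconnected G" using X uv by (auto simp: disconnected_def connected_conv)
  qed
qed

abbreviation (input) star :: "nat \<Rightarrow> (nat \<Rightarrow> nat, (nat \<Rightarrow> nat) \<times> (nat \<Rightarrow> nat)) pre_digraph" where
  "star n \<equiv> with_proj (star_graph n)"

abbreviation (input) perms :: "nat \<Rightarrow> (nat \<Rightarrow> nat) set" where
  "perms n \<equiv> {p. p permutes {1..n}}"

abbreviation (input) swap1 :: "(nat \<Rightarrow> nat) \<Rightarrow> nat \<Rightarrow> nat \<Rightarrow> nat" where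
  "swap1 p i \<equiv> p \<circ> transpose 1 i"

lemma swap1_apply:
  "swap1 p i 1 = p i" "swap1 p i i = p 1" "x \<noteq> 1 \<Longrightarrow> x \<noteq> i \<Longrightarrow> swap1 p i x = p x"
  by simp_all

lemma permutes_eq_arrangements: "{p. p permutes S} = arrangements S S id"
  by (auto simp: arrangements_def permutes_not_in intro: permutes_imp_bij bij_imp_permutes)

lemma finite_perms: "finite (perms n)" by (simp add: finite_permutations)

lemma swap1_perms: "p \<in> perms n \<Longrightarrow> i \<in> {2..n} \<Longrightarrow> swap1 p i \<in> perms n"
  by (auto intro!: permutes_compose permutes_swap_id)

lemma swap1_inj_on:
  assumes "p \<in> perms n"
  shows "inj_on (swap1 p) {2..n}"
proof (rule inj_onI)
  fix i j assume "swap1 p i = swap1 p j"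
  then have "swap1 p i 1 = swap1 p j 1" by (rule arg_cong)
  then have "p i = p j" by (simp only: swap1_apply)
  then show "i = j" using assms by (simp add: inj_eq permutes_inj)
qed

lemma wf_star: "wf_digraph (star n)"
proof -
  interpret pair_graph "star_graph n" by (rule pair_graph_star_graph)
  show ?thesis by (rule wf_digraph_axioms)
qed

lemma wf_delete_verts: "wf_digraph G \<Longrightarrow> wf_digraph (delete_verts G S)"
  by (simp add: delete_verts_def wf_digraph.wellformed_induce_subgraph)

lemma wf_delete_edges: "wf_digraph G \<Longrightarrow> wf_digraph (delete_edges G F)"
  by (auto simp: delete_edges_def wf_digraph_def)

lemma out_degree_delete_verts:
  assumes "p \<in> perms n - S"
  shows "out_degree (delete_verts (star n) S) p = card {i \<in> {2..n}. swap1 p i \<notin> S}"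
proof -
  have "out_arcs (delete_verts (star n) S) p = (\<lambda>i. (p, swap1 p i)) ` {i \<in> {2..n}. swap1 p i \<notin> S}"
    using assms swap1_perms[of p n]
    by (auto simp: out_arcs_def delete_verts_def star_graph_def)
  moreover have "inj_on (\<lambda>i. (p, swap1 p i)) {i \<in> {2..n}. swap1 p i \<notin> S}"
    using swap1_inj_on[of p n] assms by (auto simp: inj_on_def)
  ultimately show ?thesis by (simp add: out_degree_def card_image)
qed

lemma out_degree_delete_edges:
  assumes "p \<in> perms n"
  shows "out_degree (delete_edges (star n) F) p = card {i \<in> {2..n}. {p, swap1 p i} \<notin> F}"
proof -
  have "out_arcs (delete_edges (star n) F) p = (\<lambda>i. (p, swap1 p i)) ` {i \<in> {2..n}. {p, swap1 p i} \<notin> F}"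
    using assms by (auto simp: out_arcs_def delete_edges_def star_graph_def)
  moreover have "inj_on (\<lambda>i. (p, swap1 p i)) {i \<in> {2..n}. {p, swap1 p i} \<notin> F}"
    using swap1_inj_on[of p n] assms by (auto simp: inj_on_def)
  ultimately show ?thesis by (simp add: out_degree_def card_image)
qed

lemma vertex_cut_star_iff:
  "vertex_cut k (star n) T \<longleftrightarrow> T \<subseteq> perms n
    \<and> (\<exists>X \<subseteq> perms n - T. X \<noteq> {} \<and> X \<noteq> perms n - T
        \<and> (\<forall>p \<in> perms n - T. \<forall>i \<in> {2..n}. swap1 p i \<notin> T \<longrightarrow> (p \<in> X \<longleftrightarrow> swap1 p i \<in> X)))
    \<and> (\<forall>p \<in> perms n - T. k \<le> card {i \<in> {2..n}. swap1 p i \<notin> T})"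
proof -
  let ?G = "delete_verts (star n) T"
  have verts: "verts (star n) = perms n" "verts ?G = perms n - T"
    by (simp_all add: delete_verts_def star_graph_def)
  have arcs: "(\<forall>e \<in> arcs ?G. tail ?G e \<in> X \<longleftrightarrow> head ?G e \<in> X) \<longleftrightarrow>
      (\<forall>p \<in> perms n - T. \<forall>i \<in> {2..n}. swap1 p i \<notin> T \<longrightarrow> (p \<in> X \<longleftrightarrow> swap1 p i \<in> X))" for X
  proof -
    have "arcs ?G = {(p, swap1 p i) | p i. p \<in> perms n - T \<and> i \<in> {2..n} \<and> swap1 p i \<notin> T}"
      using swap1_perms[of _ n] by (auto simp: delete_verts_def star_graph_def)
    moreover have "tail ?G = fst" "head ?G = snd" by (simp_all add: delete_verts_def)
    ultimately show ?thesis by fastforce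
  qed
  show ?thesis
    unfolding vertex_cut_def disconnected_iff[OF wf_delete_verts[OF wf_star]] verts arcs
    using out_degree_delete_verts[of _ n T] by simp
qed

lemma edge_cut_star_iff:
  "edge_cut k (star n) F \<longleftrightarrow> F \<subseteq> {{p, swap1 p i} | p i. p \<in> perms n \<and> i \<in> {2..n}}
    \<and> (\<exists>X \<subseteq> perms n. X \<noteq> {} \<and> X \<noteq> perms n
        \<and> (\<forall>p \<in> perms n. \<forall>i \<in> {2..n}. {p, swap1 p i} \<notin> F \<longrightarrow> (p \<in> X \<longleftrightarrow> swap1 p i \<in> X)))
    \<and> (\<forall>p \<in> perms n. k \<le> card {i \<in> {2..n}. {p, swap1 p i} \<notin> F})"
proof -
  let ?G = "delete_edges (star n) F"
  have verts: "verts ?G = perms n"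
    by (simp add: delete_edges_def star_graph_def)
  have edges: "edges (star n) = {{p, swap1 p i} | p i. p \<in> perms n \<and> i \<in> {2..n}}"
    by (auto simp: edges_def star_graph_def)
  have arcs: "(\<forall>e \<in> arcs ?G. tail ?G e \<in> X \<longleftrightarrow> head ?G e \<in> X) \<longleftrightarrow>
      (\<forall>p \<in> perms n. \<forall>i \<in> {2..n}. {p, swap1 p i} \<notin> F \<longrightarrow> (p \<in> X \<longleftrightarrow> swap1 p i \<in> X))" for X
  proof -
    have "arcs ?G = {(p, swap1 p i) | p i. p \<in> perms n \<and> i \<in> {2..n} \<and> {p, swap1 p i} \<notin> F}"
      by (auto simp: delete_edges_def star_graph_def)
    moreover have "tail ?G = fst" "head ?G = snd" by (simp_all add: delete_edges_def)
    ultimately show ?thesis by fastforce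
  qed
  show ?thesis
    unfolding edge_cut_def disconnected_iff[OF wf_delete_edges[OF wf_star]] verts arcs edges
    using out_degree_delete_edges[of _ n F] by simp
qed

section \<open>Lower bounds for the cuts\<close>

lemma disjoint_pair_perms:
  assumes "1 \<le> n" and "X \<subseteq> perms n" "Y \<subseteq> perms n" "X \<inter> Y = {}"
  shows "disjoint_pair {1..n} 1 {1..n} id X Y"
  using assms by unfold_locales (simp_all add: permutes_eq_arrangements)

lemma moves_perms: "moves {1..n} 1 X p = {i \<in> {2..n}. swap1 p i \<in> X}"
  by (auto simp: moves_def)

lemma cost_perms:
  "cost {1..n} 1 {1..n} id X Y
    = card (perms n - (X \<union> Y)) + card (SIGMA p:X. {i \<in> {2..n}. swap1 p i \<in> Y})"
  by (simp only: cost_def moves_perms permutes_eq_arrangements)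

lemma perms_cost_ge:
  assumes "2 \<le> n" "k \<le> n - 2" and X: "X \<subseteq> perms n" "X \<noteq> {}" and Y: "Y \<subseteq> perms n" "Y \<noteq> {}"
    and "X \<inter> Y = {}"
    and degX: "\<And>p. p \<in> X \<Longrightarrow> k \<le> card {i \<in> {2..n}. swap1 p i \<in> X}"
    and degY: "\<And>p. p \<in> Y \<Longrightarrow> k \<le> card {i \<in> {2..n}. swap1 p i \<in> Y}"
  shows "fact (k + 1) * (n - k - 1)
    \<le> card (perms n - (X \<union> Y)) + card (SIGMA p:X. {i \<in> {2..n}. swap1 p i \<in> Y})"
proof -
  have "fact (k + 1) * (card {1..n} - k - 1) \<le> cost {1..n} 1 {1..n} id X Y"
    using assms by (intro cost_ge_fact disjoint_pair_perms) (simp_all only: moves_perms, auto)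
  then show ?thesis by (simp only: cost_perms card_atLeastAtMost) simp
qed

lemma vertex_cut_card_ge:
  assumes n: "2 \<le> n" "k \<le> n - 2" and cut: "vertex_cut k (star n) T"
  shows "fact (k + 1) * (n - k - 1) \<le> card T"
proof -
  obtain X where T: "T \<subseteq> perms n" and X: "X \<subseteq> perms n - T" "X \<noteq> {}" "X \<noteq> perms n - T"
    and closed: "\<And>p i. p \<in> perms n - T \<Longrightarrow> i \<in> {2..n} \<Longrightarrow> swap1 p i \<notin> T \<Longrightarrow> p \<in> X \<longleftrightarrow> swap1 p i \<in> X"
    and deg: "\<And>p. p \<in> perms n - T \<Longrightarrow> k \<le> card {i \<in> {2..n}. swap1 p i \<notin> T}"
    using cut unfolding vertex_cut_star_iff by blast
  define Y where "Y = perms n - T - X"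
  have XY: "X \<subseteq> perms n" "Y \<subseteq> perms n" "X \<inter> Y = {}" "Y \<noteq> {}" "perms n - (X \<union> Y) = T"
    using X T by (auto simp: Y_def)
  have stay: "{i \<in> {2..n}. swap1 p i \<notin> T} \<subseteq> {i \<in> {2..n}. swap1 p i \<in> X}" if "p \<in> X" for p
    using closed that X(1) by blast
  have stayY: "{i \<in> {2..n}. swap1 p i \<notin> T} \<subseteq> {i \<in> {2..n}. swap1 p i \<in> Y}" if "p \<in> Y" for p
  proof -
    have "swap1 p i \<in> Y" if i: "i \<in> {2..n}" "swap1 p i \<notin> T" for i
      using closed[OF _ i] \<open>p \<in> Y\<close> swap1_perms[OF _ i(1), of p] i(2) by (simp add: Y_def)
    then show ?thesis by blast
  qed
  have "(SIGMA p:X. {i \<in> {2..n}. swap1 p i \<in> Y}) = {}"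
    using closed X(1) by (fastforce simp: Y_def)
  moreover have "k \<le> card {i \<in> {2..n}. swap1 p i \<in> X}" if "p \<in> X" for p
    using deg[of p] card_mono[OF _ stay[OF that]] that X(1) by fastforce
  moreover have "k \<le> card {i \<in> {2..n}. swap1 p i \<in> Y}" if "p \<in> Y" for p
    using deg[of p] card_mono[OF _ stayY[OF that]] that by (fastforce simp: Y_def)
  ultimately show ?thesis
    using perms_cost_ge[OF n XY(1) X(2) XY(2,4,3)] XY(5) by simp
qed

lemma edge_cut_card_ge:
  assumes n: "2 \<le> n" "k \<le> n - 2" and cut: "edge_cut k (star n) F"
  shows "fact (k + 1) * (n - k - 1) \<le> card F"
proof -
  obtain X where F: "F \<subseteq> {{p, swap1 p i} | p i. p \<in> perms n \<and> i \<in> {2..n}}"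
    and X: "X \<subseteq> perms n" "X \<noteq> {}" "X \<noteq> perms n"
    and closed: "\<And>p i. p \<in> perms n \<Longrightarrow> i \<in> {2..n} \<Longrightarrow> {p, swap1 p i} \<notin> F \<Longrightarrow> p \<in> X \<longleftrightarrow> swap1 p i \<in> X"
    and deg: "\<And>p. p \<in> perms n \<Longrightarrow> k \<le> card {i \<in> {2..n}. {p, swap1 p i} \<notin> F}"
    using cut unfolding edge_cut_star_iff by blast
  define Y where "Y = perms n - X"
  have XY: "Y \<subseteq> perms n" "X \<inter> Y = {}" "Y \<noteq> {}" "perms n - (X \<union> Y) = {}"
    using X by (auto simp: Y_def)
  have stay: "{i \<in> {2..n}. {p, swap1 p i} \<notin> F} \<subseteq> {i \<in> {2..n}. swap1 p i \<in> X}" if "p \<in> X" for p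
    using closed that X(1) by blast
  have stayY: "{i \<in> {2..n}. {p, swap1 p i} \<notin> F} \<subseteq> {i \<in> {2..n}. swap1 p i \<in> Y}" if "p \<in> Y" for p
  proof -
    have "swap1 p i \<in> Y" if i: "i \<in> {2..n}" "{p, swap1 p i} \<notin> F" for i
      using closed[OF _ i] \<open>p \<in> Y\<close> swap1_perms[OF _ i(1), of p] by (simp add: Y_def)
    then show ?thesis by blast
  qed
  let ?E = "SIGMA p:X. {i \<in> {2..n}. swap1 p i \<in> Y}"
  let ?e = "\<lambda>(p, i). {p, swap1 p i}"
  have "F \<subseteq> Pow (perms n)" using F swap1_perms by fastforce
  then have finF: "finite F" using finite_perms finite_subset by (metis finite_Pow_iff)
  \<comment> \<open>An edge between \<open>X\<close> and \<open>Y\<close> determines its end in \<open>X\<close>.\<close>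
  have "inj_on ?e ?E"
  proof (rule inj_onI)
    fix a b assume ab: "a \<in> ?E" "b \<in> ?E" "?e a = ?e b"
    obtain p i q j where a: "a = (p, i)" "b = (q, j)" by (cases a, cases b)
    have "p \<in> X" "q \<in> X" "swap1 p i \<notin> X" "swap1 q j \<notin> X" "i \<in> {2..n}" "j \<in> {2..n}"
      using ab(1,2) XY(2) unfolding a by blast+
    moreover have "{p, swap1 p i} = {q, swap1 q j}" using ab(3) unfolding a by simp
    ultimately have "p = q" "swap1 p i = swap1 p j" by (metis doubleton_eq_iff)+
    moreover have "i = j"
    proof (rule inj_onD)
      show "inj_on (swap1 p) {2..n}" using \<open>p \<in> X\<close> X(1) by (intro swap1_inj_on) blast
    qed fact+
    ultimately show "a = b" unfolding a by simp
  qed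
  moreover have "?e ` ?E \<subseteq> F" using closed X(1) by (fastforce simp: Y_def)
  ultimately have "card ?E \<le> card F" using finF by (rule card_inj_on_le)
  moreover have "k \<le> card {i \<in> {2..n}. swap1 p i \<in> X}" if "p \<in> X" for p
    using deg[of p] card_mono[OF _ stay[OF that]] that X(1) by fastforce
  moreover have "k \<le> card {i \<in> {2..n}. swap1 p i \<in> Y}" if "p \<in> Y" for p
    using deg[of p] card_mono[OF _ stayY[OF that]] that by (fastforce simp: Y_def)
  ultimately show ?thesis
    using perms_cost_ge[OF n X(1,2) XY(1,3,2)] unfolding XY(4) by simp
qed

lemma perms_mono: "m \<le> n \<Longrightarrow> perms m \<subseteq> perms n"
  by (intro Collect_mono impI permutes_subset[of _ "{1..m}" "{1..n}"]) auto

lemma perms_fixes: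
  assumes "p \<in> perms m" and "m < l"
  shows "p l = l"
  using permutes_not_in[of p "{1..m}" l] assms by simp

lemma perms_one_le: "p \<in> perms m \<Longrightarrow> 1 \<le> m \<Longrightarrow> p 1 \<le> m"
  using permutes_in_image[of p "{1..m}" 1] by simp

lemma swap1_notin_substar:
  assumes "p \<in> perms m" and "1 \<le> m" and "m < i"
  shows "swap1 p i \<notin> perms m"
proof
  assume "swap1 p i \<in> perms m"
  then have "swap1 p i i = i" using assms(3) by (rule perms_fixes)
  then show False using perms_one_le[OF assms(1,2)] assms(3) by simp
qed

lemma swap1_in_substar_iff:
  assumes "p \<in> perms m" and "1 \<le> m" and "2 \<le> i"
  shows "swap1 p i \<in> perms m \<longleftrightarrow> i \<le> m"
proof (cases "i \<le> m")
  case True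
  then show ?thesis using swap1_perms[of p m i] assms by simp
next
  case False
  then show ?thesis using swap1_notin_substar[of p m i] assms by simp
qed

section \<open>The cuts around a substar\<close>

definition boundary :: "nat \<Rightarrow> nat \<Rightarrow> (nat \<Rightarrow> nat) set" where
  "boundary m n = (\<lambda>(p, i). swap1 p i) ` (perms m \<times> {m<..n})"

definition boundary_edges :: "nat \<Rightarrow> nat \<Rightarrow> (nat \<Rightarrow> nat) set set" where
  "boundary_edges m n = (\<lambda>(p, i). {p, swap1 p i}) ` (perms m \<times> {m<..n})"

lemma card_boundary_le:
  "card (boundary m n) \<le> fact m * (n - m)" "card (boundary_edges m n) \<le> fact m * (n - m)"
proof -
  have "card (perms m) = fact m" by (rule card_permutations) auto
  then have card: "card (perms m \<times> {m<..n}) = fact m * (n - m)"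
    by (simp add: card_cartesian_product)
  have fin: "finite (perms m \<times> {m<..n})"
    by (intro finite_cartesian_product finite_perms finite_greaterThanAtMost)
  show "card (boundary m n) \<le> fact m * (n - m)"
    using card_image_le[OF fin] unfolding boundary_def card .
  show "card (boundary_edges m n) \<le> fact m * (n - m)"
    using card_image_le[OF fin] unfolding boundary_edges_def card .
qed

text \<open>
  An exchange that leads into the substar is along a position \<open>i\<close> beyond \<open>m\<close>; it takes a
  symbol at most \<open>m\<close> from there, whereas an exchange along another position would leave that symbol.
\<close>

lemma one_substar_neighbour:
  assumes v: "v \<notin> perms m" and m: "1 \<le> m"
    and i: "swap1 v i \<in> perms m" "2 \<le> i" and j: "swap1 v j \<in> perms m" "2 \<le> j"
  shows "i = j"
proof (rule ccontr)
  assume "i \<noteq> j"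
  have big: "m < i" if "swap1 v i \<in> perms m" "2 \<le> i" for i
  proof (rule ccontr)
    assume "\<not> m < i"
    then have "i \<in> {2..m}" using that(2) by simp
    with that(1) have "swap1 (swap1 v i) i \<in> perms m" by (rule swap1_perms)
    then show False using v unfolding comp_transpose_twice by contradiction
  qed
  have "v i = swap1 v j i" using i(2) \<open>i \<noteq> j\<close> by simp
  also have "\<dots> = i" using j(1) big[OF i] by (rule perms_fixes)
  finally have "v i = i" .
  have "v i \<le> m" using perms_one_le[OF i(1) m] by simp
  then show False using big[OF i] \<open>v i = i\<close> by linarith
qed

text \<open>
  A neighbour of the substar differs from the identity beyond \<open>m\<close> in one position \<open>i\<close> only, and has
  the symbol \<open>i\<close> in the centre. If the exchange along \<open>j\<close> takes \<open>v\<close> to it, then \<open>i\<close> is the only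
  position of \<open>v\<close> beyond \<open>m\<close> with a symbol at most \<open>m\<close>, and \<open>j\<close> is the position of the symbol \<open>i\<close>.
\<close>

lemma one_boundary_neighbour:
  assumes v: "v \<notin> perms m" "v \<in> perms n" and m: "1 \<le> m"
    and j: "swap1 v j \<in> boundary m n" "2 \<le> j" and j': "swap1 v j' \<in> boundary m n" "2 \<le> j'"
  shows "j = j'"
proof -
  have shape: "\<exists>i. m < i \<and> v j = i \<and> v i \<le> m \<and> (\<forall>l. m < l \<and> l \<noteq> i \<and> l \<noteq> j \<longrightarrow> v l = l)"
    if j: "swap1 v j \<in> boundary m n" "2 \<le> j" for j
  proof -
    obtain p i where p: "p \<in> perms m" and i: "m < i" and eq: "swap1 v j = swap1 p i"
      using j(1) by (auto simp: boundary_def)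
    have vp: "v = swap1 (swap1 p i) j" unfolding eq[symmetric] comp_transpose_twice ..
    have fixes_p: "p l = l" if "m < l" for l using p that by (rule perms_fixes)
    have ij: "i \<noteq> j"
    proof
      assume "i = j"
      then have "v = p" unfolding vp by simp
      then show False using p v(1) by simp
    qed
    have "v j = i" unfolding vp using fixes_p[OF i] by simp
    moreover have "v i \<le> m" unfolding vp using ij i m perms_one_le[OF p m] by simp
    moreover have "v l = l" if "m < l" "l \<noteq> i" "l \<noteq> j" for l
      unfolding vp using that m fixes_p[of l] by simp
    ultimately show ?thesis using i by blast
  qed
  obtain i where i: "m < i" "v j = i" "v i \<le> m"
    using shape[OF j] by blast
  obtain i' where i': "m < i'" "v j' = i'" "\<And>l. m < l \<Longrightarrow> l \<noteq> i' \<Longrightarrow> l \<noteq> j' \<Longrightarrow> v l = l"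
    using shape[OF j'] by blast
  have "i = i'"
  proof (rule ccontr)
    assume "i \<noteq> i'"
    then have "v i = i \<or> i = j'" using i(1) i'(3) by blast
    then show False using i i'(1,2) by auto
  qed
  then have "v j = v j'" using i i' by simp
  then show ?thesis using v(2) by (simp add: inj_eq permutes_inj)
qed

lemma card_all_but_one_ge:
  assumes "\<And>i j. i \<in> {2..n} \<Longrightarrow> j \<in> {2..n} \<Longrightarrow> \<not> P i \<Longrightarrow> \<not> P j \<Longrightarrow> i = j"
  shows "n - 2 \<le> card {i \<in> {2..n}. P i}"
proof -
  have "card {i \<in> {2..n}. \<not> P i} \<le> 1"
    using assms by (intro card_le_Suc0_iff_eq[THEN iffD2, folded One_nat_def]) auto
  moreover have "{i \<in> {2..n}. P i} \<union> {i \<in> {2..n}. \<not> P i} = {2..n}" by blast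
  then have "card {2..n} \<le> card {i \<in> {2..n}. P i} + card {i \<in> {2..n}. \<not> P i}"
    using card_Un_le[of "{i \<in> {2..n}. P i}" "{i \<in> {2..n}. \<not> P i}"] by (simp only:)
  ultimately show ?thesis by simp
qed

text \<open>
  The neighbours of the substar separate it from \<open>transpose 2 n\<close>, which moves \<open>n\<close> but keeps \<open>1\<close> in the
  centre; for \<open>n = 2\<close> no vertex remains outside.
\<close>

lemma vertex_cut_boundary:
  assumes "3 \<le> n" and m: "1 \<le> m" "m < n"
  shows "vertex_cut (m - 1) (star n) (boundary m n)"
proof -
  let ?X = "perms m" and ?N = "boundary m n"
  have sub: "?X \<subseteq> perms n" using m by (intro perms_mono) simp
  have N_sub: "?N \<subseteq> perms n"
  proof
    fix q assume "q \<in> ?N"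
    then obtain p i where p: "p \<in> ?X" "i \<in> {m<..n}" and q: "q = swap1 p i"
      by (auto simp: boundary_def)
    show "q \<in> perms n" unfolding q using p sub m by (intro swap1_perms) auto
  qed
  have leave: "swap1 p i \<in> ?N" if "p \<in> ?X" "i \<in> {2..n}" "m < i" for p i
    using that by (force simp: boundary_def)
  have disj: "q \<notin> ?X" if "q \<in> ?N" for q
  proof -
    obtain p i where p: "p \<in> ?X" "m < i" and q: "q = swap1 p i"
      using \<open>q \<in> ?N\<close> by (auto simp: boundary_def)
    show ?thesis unfolding q using p(1) m(1) p(2) by (rule swap1_notin_substar)
  qed
  have id: "id \<in> ?X" by (simp add: permutes_id)
  have out: "transpose 2 n \<in> perms n - ?N" "transpose 2 n \<notin> ?X"
  proof -
    have "q 1 > m" if "q \<in> ?N" for q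
    proof -
      obtain p i where p: "p \<in> ?X" "m < i" and q: "q = swap1 p i"
        using \<open>q \<in> ?N\<close> by (auto simp: boundary_def)
      show ?thesis unfolding q using perms_fixes[OF p] p(2) by simp
    qed
    moreover have "transpose 2 n 1 = (1 :: nat)" using \<open>3 \<le> n\<close> by simp
    ultimately have "transpose 2 n \<notin> ?N" using m(1) by (metis not_less)
    then show "transpose 2 n \<in> perms n - ?N"
      using \<open>3 \<le> n\<close> permutes_swap_id[of 2 "{1..n}" n] by simp
    show "transpose 2 n \<notin> ?X"
      using perms_fixes[of "transpose 2 n" m n] m(2) \<open>3 \<le> n\<close> by auto
  qed
  have inner: "swap1 p i \<in> ?X" if "p \<in> ?X" "i \<in> {2..n}" "swap1 p i \<notin> ?N" for p i
    using leave[OF that(1,2)] that swap1_in_substar_iff[OF that(1) m(1), of i] by fastforce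
  have closed: "p \<in> ?X \<longleftrightarrow> swap1 p i \<in> ?X"
    if p: "p \<in> perms n - ?N" and i: "i \<in> {2..n}" "swap1 p i \<notin> ?N" for p i
  proof
    assume in_X: "swap1 p i \<in> ?X"
    have "swap1 (swap1 p i) i \<notin> ?N" using p unfolding comp_transpose_twice by blast
    with in_X i(1) have "swap1 (swap1 p i) i \<in> ?X" by (rule inner)
    then show "p \<in> ?X" unfolding comp_transpose_twice .
  qed (use inner i in blast)
  have deg: "m - 1 \<le> card {i \<in> {2..n}. swap1 p i \<notin> ?N}" if p: "p \<in> perms n - ?N" for p
  proof (cases "p \<in> ?X")
    case True
    have "{2..m} \<subseteq> {i \<in> {2..n}. swap1 p i \<notin> ?N}"
    proof
      fix i assume i: "i \<in> {2..m}"
      then have "swap1 p i \<in> ?X" by (rule swap1_perms[OF True])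
      then show "i \<in> {i \<in> {2..n}. swap1 p i \<notin> ?N}" using disj i m by auto
    qed
    then have "card {2..m} \<le> card {i \<in> {2..n}. swap1 p i \<notin> ?N}" by (intro card_mono) auto
    then show ?thesis by simp
  next
    case False
    have "n - 2 \<le> card {i \<in> {2..n}. swap1 p i \<notin> ?N}"
    proof (rule card_all_but_one_ge)
      fix i j assume "i \<in> {2..n}" "j \<in> {2..n}" "\<not> swap1 p i \<notin> ?N" "\<not> swap1 p j \<notin> ?N"
      then show "i = j" using one_boundary_neighbour[OF False _ m(1), of n i j] p by simp
    qed
    then show ?thesis using m by linarith
  qed
  have "\<exists>X \<subseteq> perms n - ?N. X \<noteq> {} \<and> X \<noteq> perms n - ?N
      \<and> (\<forall>p \<in> perms n - ?N. \<forall>i \<in> {2..n}. swap1 p i \<notin> ?N \<longrightarrow> (p \<in> X \<longleftrightarrow> swap1 p i \<in> X))"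
  proof (intro exI conjI ballI impI)
    show "?X \<subseteq> perms n - ?N" using sub disj by blast
    show "?X \<noteq> {}" using id by blast
    show "?X \<noteq> perms n - ?N" using out by blast
  qed (rule closed)
  then show ?thesis unfolding vertex_cut_star_iff using N_sub deg by blast
qed

lemma edge_cut_boundary_edges:
  assumes "2 \<le> n" and m: "1 \<le> m" "m < n"
  shows "edge_cut (m - 1) (star n) (boundary_edges m n)"
proof -
  let ?X = "perms m" and ?F = "boundary_edges m n"
  have sub: "?X \<subseteq> perms n" using m by (intro perms_mono) simp
  have F_sub: "?F \<subseteq> {{p, swap1 p i} | p i. p \<in> perms n \<and> i \<in> {2..n}}"
    using sub m by (fastforce simp: boundary_edges_def)
  have leave: "{p, swap1 p i} \<in> ?F" if "p \<in> ?X" "i \<in> {2..n}" "m < i" for p i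
    using that by (force simp: boundary_edges_def)
  have crossing: "e \<inter> ?X \<noteq> {} \<and> \<not> e \<subseteq> ?X" if "e \<in> ?F" for e
  proof -
    obtain p i where p: "p \<in> ?X" "m < i" and e: "e = {p, swap1 p i}"
      using \<open>e \<in> ?F\<close> by (auto simp: boundary_edges_def)
    have "swap1 p i \<notin> ?X" using p(1) m(1) p(2) by (rule swap1_notin_substar)
    then show ?thesis unfolding e using p(1) by blast
  qed
  have id: "id \<in> ?X" by (simp add: permutes_id)
  have out: "transpose 1 n \<in> perms n" "transpose 1 n \<notin> ?X"
    using \<open>2 \<le> n\<close> permutes_swap_id[of 1 "{1..n}" n] perms_fixes[of "transpose 1 n" m n] m(2) by auto
  have inner: "swap1 p i \<in> ?X" if "p \<in> ?X" "i \<in> {2..n}" "{p, swap1 p i} \<notin> ?F" for p i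
    using leave[OF that(1,2)] that swap1_in_substar_iff[OF that(1) m(1), of i] by fastforce
  have closed: "p \<in> ?X \<longleftrightarrow> swap1 p i \<in> ?X"
    if p: "p \<in> perms n" and i: "i \<in> {2..n}" "{p, swap1 p i} \<notin> ?F" for p i
  proof
    assume in_X: "swap1 p i \<in> ?X"
    have "{swap1 p i, swap1 (swap1 p i) i} \<notin> ?F"
      using i(2) unfolding comp_transpose_twice by (simp only: insert_commute not_False_eq_True)
    with in_X i(1) have "swap1 (swap1 p i) i \<in> ?X" by (rule inner)
    then show "p \<in> ?X" unfolding comp_transpose_twice .
  qed (use inner i in blast)
  have deg: "m - 1 \<le> card {i \<in> {2..n}. {p, swap1 p i} \<notin> ?F}" if p: "p \<in> perms n" for p
  proof (cases "p \<in> ?X")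
    case True
    have "{2..m} \<subseteq> {i \<in> {2..n}. {p, swap1 p i} \<notin> ?F}"
    proof
      fix i assume i: "i \<in> {2..m}"
      then have "swap1 p i \<in> ?X" by (rule swap1_perms[OF True])
      then have "{p, swap1 p i} \<notin> ?F" using crossing True by blast
      then show "i \<in> {i \<in> {2..n}. {p, swap1 p i} \<notin> ?F}" using i m by simp
    qed
    then have "card {2..m} \<le> card {i \<in> {2..n}. {p, swap1 p i} \<notin> ?F}" by (intro card_mono) auto
    then show ?thesis by simp
  next
    case False
    have "n - 2 \<le> card {i \<in> {2..n}. {p, swap1 p i} \<notin> ?F}"
    proof (rule card_all_but_one_ge)
      fix i j assume ij: "i \<in> {2..n}" "j \<in> {2..n}"
        "\<not> {p, swap1 p i} \<notin> ?F" "\<not> {p, swap1 p j} \<notin> ?F"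
      then have "swap1 p i \<in> ?X" "swap1 p j \<in> ?X" using crossing False by blast+
      then show "i = j" using ij(1,2) by (intro one_substar_neighbour[OF False m(1)]) simp_all
    qed
    then show ?thesis using m by linarith
  qed
  have "\<exists>X \<subseteq> perms n. X \<noteq> {} \<and> X \<noteq> perms n
      \<and> (\<forall>p \<in> perms n. \<forall>i \<in> {2..n}. {p, swap1 p i} \<notin> ?F \<longrightarrow> (p \<in> X \<longleftrightarrow> swap1 p i \<in> X))"
  proof (intro exI conjI ballI impI)
    show "?X \<subseteq> perms n" by (rule sub)
    show "?X \<noteq> {}" using id by blast
    show "?X \<noteq> perms n" using out by blast
  qed (rule closed)
  then show ?thesis unfolding edge_cut_star_iff using F_sub deg by blast
qed

section \<open>The two connectivities\<close>

lemma complete_star_iff: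
  assumes "2 \<le> n"
  shows "complete_digraph (card (verts (star n))) (star n) \<longleftrightarrow> n = 2"
proof
  assume "n = 2"
  have ne: "id \<noteq> transpose (1::nat) 2"
    by (metis id_apply transpose_apply_first one_eq_numeral_iff num.distinct(1))
  have p2: "perms 2 = {id, transpose 1 2}"
  proof -
    have "card (perms 2) = 2" using card_permutations[of "{1..2::nat}" 2] by (simp add: fact_2)
    moreover have "{id, transpose 1 2} \<subseteq> perms 2"
      using permutes_swap_id[of "1::nat" "{1..2}" 2] by (simp add: permutes_id)
    ultimately show ?thesis using ne finite_perms[of 2] by (intro card_seteq[symmetric]) auto
  qed
  have arcs: "parcs (star_graph 2) = {(p, swap1 p 2) | p. p \<in> perms 2}"
    by (auto simp: star_graph_def)
  have "parcs (star_graph 2) = {(u, v). (u, v) \<in> perms 2 \<times> perms 2 \<and> u \<noteq> v}"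
    unfolding arcs p2 using ne by (auto simp del: One_nat_def)
  then show "complete_digraph (card (verts (star n))) (star n)"
    unfolding complete_digraph_pair_def \<open>n = 2\<close> using finite_perms[of 2]
    by (simp add: star_graph_def)
next
  assume complete: "complete_digraph (card (verts (star n))) (star n)"
  show "n = 2"
  proof (rule ccontr)
    assume "n \<noteq> 2"
    then have n: "3 \<le> n" using assms by simp
    have "transpose 2 n n \<noteq> id n" using n by simp
    then have "id \<noteq> transpose 2 n" by metis
    moreover have "id \<in> perms n" "transpose 2 n \<in> perms n"
      using n permutes_swap_id[of 2 "{1..n}" n] by (simp_all add: permutes_id)
    ultimately have "(id, transpose 2 n) \<in> parcs (star_graph n)"
      using complete unfolding complete_digraph_pair_def by (simp add: star_graph_def)
    then obtain i where "i \<in> {2..n}" "transpose 2 n = swap1 id i"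
      by (auto simp: star_graph_def)
    then have "transpose 2 n 1 = i" by simp
    then show False using n \<open>i \<in> _\<close> by simp
  qed
qed

lemma INF_enat_eq:
  assumes "P a" and "card a \<le> N" and "\<And>b. P b \<Longrightarrow> N \<le> card b"
  shows "(INF S \<in> {S. P S}. enat (card S)) = enat N"
proof (rule antisym)
  show "(INF S \<in> {S. P S}. enat (card S)) \<le> enat N"
    using assms(1,2) by (intro INF_lower2[of a]) auto
  show "enat N \<le> (INF S \<in> {S. P S}. enat (card S))"
    using assms(3) by (intro INF_greatest) auto
qed

theorem theorem3p3:
  fixes n k :: nat
  assumes "n \<ge> 2" and "k \<le> n - 2"
  shows "super_connectivity k (with_proj (star_graph n)) = enat (fact (k + 1) * (n - k - 1))
       \<and> super_edge_connectivity k (with_proj (star_graph n)) = enat (fact (k + 1) * (n - k - 1))"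
proof
  have m: "1 \<le> k + 1" "k + 1 < n" using assms by linarith+
  show "super_edge_connectivity k (star n) = enat (fact (k + 1) * (n - k - 1))"
    unfolding super_edge_connectivity_def
  proof (rule INF_enat_eq)
    show "edge_cut k (star n) (boundary_edges (k + 1) n)"
      using edge_cut_boundary_edges[OF assms(1) m] by simp
    show "card (boundary_edges (k + 1) n) \<le> fact (k + 1) * (n - k - 1)"
      using card_boundary_le(2)[of "k + 1" n] unfolding diff_diff_left .
  qed (rule edge_cut_card_ge[OF assms])
  show "super_connectivity k (star n) = enat (fact (k + 1) * (n - k - 1))"
  proof (cases "n = 2")
    case True
    have "card (verts (star n)) = 2"
      using True card_permutations[of "{1..2::nat}" 2] by (simp add: star_graph_def fact_2)
    then show ?thesis
      using complete_star_iff[OF assms(1)] True assms(2) by (simp add: super_connectivity_def)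
  next
    case False
    then have "\<not> complete_digraph (card (verts (star n))) (star n)"
      using complete_star_iff[OF assms(1)] by blast
    then have "super_connectivity k (star n) = (INF S \<in> {S. vertex_cut k (star n) S}. enat (card S))"
      by (simp add: super_connectivity_def)
    also have "\<dots> = enat (fact (k + 1) * (n - k - 1))"
    proof (rule INF_enat_eq)
      show "vertex_cut k (star n) (boundary (k + 1) n)"
        using vertex_cut_boundary[OF _ m] assms(1) False by simp
      show "card (boundary (k + 1) n) \<le> fact (k + 1) * (n - k - 1)"
        using card_boundary_le(1)[of "k + 1" n] unfolding diff_diff_left .
    qed (rule vertex_cut_card_ge[OF assms])
    finally show ?thesis .
  qed
qed

end
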